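(* Suppose that $\alpha\in\mathfrak{m}^*$. (1) A point $z\in\mathbb{C}^d$ is $\alpha$-semi-stable if and only if $$\alpha\in\sum_{i=1}^d\mathbb{R}_{\ge0}\,|z_i|^2\,\iota^*e_i^*.$$ (2) Suppose $z\in(\mathbb{C}^d)^{\alpha\text{-}ss}$. Then the $M_{\mathbb{C}}$-orbit through $z$ is closed in $(\mathbb{C}^d)^{\alpha\text{-}ss}$ if and only if $$\alpha\in\sum_{i=1}^d\mathbb{R}_{>0}\,|z_i|^2\,\iota^*e_i^*.$$
   Context: Let $T^d$ be the real $d$-torus acting on $\mathbb{C}^d$ by coordinatewise multiplication, with Lie algebra $\mathfrak{t}\cong\mathbb{R}^d$, standard basis $e_1,\dots,e_d$ and dual basis $e_1^*,\dots,e_d^*$ of $\mathfrak{t}^*$. Let $M\subset T^d$ be a connected $m$-dimensional subtorus with Lie algebra $\mathfrak{m}$ (generated by integer vectors), inclusion $\iota:\mathfrak{m}\to\mathfrak{t}$, dual map $\iota^*:\mathfrak{t}^*\to\mathfrak{m}^*$, and complexification $M_{\mathbb{C}}\subset(\mathbb{C}^\times)^d$, which acts on $\mathbb{C}^d$, written $p\mapsto p\zeta$. Here $\sum_i\mathbb{R}_{\ge0}|z_i|^2\iota^*e_i^*$ (resp. $\sum_i\mathbb{R}_{>0}|z_i|^2\iota^*e_i^*$) denotes the set of all sums $\sum_i c_i|z_i|^2\iota^*e_i^*$ with all $c_i\ge0$ (resp. all $c_i>0$). Semi-stability: let $\mathfrak{m}^*_{\mathbb{Z}}\subset\mathfrak{m}^*$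 be the lattice of integral weights. An element $\alpha\in\mathfrak{m}^*_{\mathbb{Z}}$ induces a character $\chi_\alpha:M_{\mathbb{C}}\to\mathbb{C}^\times$, normalized so that $\chi_{\iota^*e_i^*}(\zeta)$ is the $i$-th coordinate of $\zeta$. For such $\alpha$, a point $z\in\mathbb{C}^d$ is $\alpha$-semi-stable if there exist an integer $k>0$ and a polynomial $f$ on $\mathbb{C}^d$ such that $f(p\zeta)=f(p)\chi_\alpha(\zeta)^k$ for all $p\in\mathbb{C}^d$, $\zeta\in M_{\mathbb{C}}$, and $f(z)\neq0$. For general real $\alpha\in\mathfrak{m}^*$, where no character is available, the notion of $\alpha$-semi-stability is extended by taking the condition in (1) as its definition; it coincides with the preceding one when $\alpha$ is integral. The set of $\alpha$-semi-stable points is denoted $(\mathbb{C}^d)^{\alpha\text{-}ss}$. *)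

theory Defs
  imports "HOL-Analysis.Analysis"
begin

text \<open>Multiplication on \<^typ>\<open>complex^'d\<close> is the library's componentwise one, so
  \<open>p * \<zeta>\<close> is the action of a torus element \<open>\<zeta>\<close> on a point \<open>p\<close>.\<close>

definition std_torus :: "(complex^'d) set" where
  "std_torus = {\<zeta>. \<forall>i. cmod (\<zeta> $ i) = 1}"

definition subtorus :: "(complex^'d) set \<Rightarrow> bool" where
  "subtorus M \<longleftrightarrow>
     M \<subseteq> std_torus \<and> 1 \<in> M \<and> (\<forall>x\<in>M. \<forall>y\<in>M. x * y \<in> M) \<and>
     (\<forall>x\<in>M. (\<chi> i. inverse (x $ i)) \<in> M) \<and> closed M \<and> connected M"

text \<open>The exponential map is normalised with the factor \<open>2 \<pi> \<i>\<close>, so that the kernel of its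
  restriction to \<open>\<real>\<^sup>d\<close> is the lattice of integer vectors.\<close>

definition torus_exp :: "complex^'d \<Rightarrow> complex^'d" where
  "torus_exp w = (\<chi> i. exp (2 * of_real pi * \<i> * w $ i))"

definition real_vec :: "real^'d \<Rightarrow> complex^'d" where
  "real_vec \<xi> = (\<chi> i. of_real (\<xi> $ i))"

definition Re_vec :: "complex^'d \<Rightarrow> real^'d" where
  "Re_vec w = (\<chi> i. Re (w $ i))"

definition Im_vec :: "complex^'d \<Rightarrow> real^'d" where
  "Im_vec w = (\<chi> i. Im (w $ i))"

definition lie_algebra :: "(complex^'d) set \<Rightarrow> (real^'d) set" where
  "lie_algebra M = {\<xi>. \<forall>t::real. torus_exp (real_vec (t *\<^sub>R \<xi>)) \<in> M}"

definition lie_algebra_complex :: "(complex^'d) set \<Rightarrow> (complex^'d) set" where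
  "lie_algebra_complex M = {w. Re_vec w \<in> lie_algebra M \<and> Im_vec w \<in> lie_algebra M}"

text \<open>As a subtorus is connected, its complexification is the image of the complexified Lie
  algebra under the exponential map.\<close>

definition complexification :: "(complex^'d) set \<Rightarrow> (complex^'d) set" where
  "complexification M = torus_exp ` lie_algebra_complex M"

text \<open>Functionals on a subspace \<open>V\<close> are functions with the default value outside \<open>V\<close>, so that
  equality in the dual space is equality of functions.\<close>

definition dual_space :: "(real^'d) set \<Rightarrow> (real^'d \<Rightarrow> real) set" where
  "dual_space V = {\<alpha> \<in> extensional V.
     (\<forall>x\<in>V. \<forall>y\<in>V. \<alpha> (x + y) = \<alpha> x + \<alpha> y) \<and> (\<forall>c. \<forall>x\<in>V. \<alpha> (c *\<^sub>R x) = c * \<alpha> x)}"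

definition iota_star :: "(complex^'d) set \<Rightarrow> (real^'d \<Rightarrow> real) \<Rightarrow> (real^'d \<Rightarrow> real)" where
  "iota_star M \<phi> = restrict \<phi> (lie_algebra M)"

definition e_star :: "'d \<Rightarrow> real^'d \<Rightarrow> real" where
  "e_star i = (\<lambda>\<xi>. \<xi> $ i)"

definition integral_weights :: "(complex^'d) set \<Rightarrow> (real^'d \<Rightarrow> real) set" where
  "integral_weights M = {\<alpha> \<in> dual_space (lie_algebra M).
     \<forall>\<xi>\<in>lie_algebra M. torus_exp (real_vec \<xi>) = 1 \<longrightarrow> \<alpha> \<xi> \<in> \<int>}"

definition complexify :: "(real^'d \<Rightarrow> real) \<Rightarrow> complex^'d \<Rightarrow> complex" where
  "complexify \<alpha> w = of_real (\<alpha> (Re_vec w)) + \<i> * of_real (\<alpha> (Im_vec w))"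

text \<open>The character of an integral weight \<open>\<alpha>\<close> sends \<open>exp (2 \<pi> \<i> w)\<close> to \<open>exp (2 \<pi> \<i> \<alpha>(w))\<close>, with
  \<open>\<alpha>\<close> extended complex linearly. Lemma \<open>weight_character_torus_exp\<close> shows that it is well
  defined, and \<open>weight_character_iota_star_e_star\<close> that the weight \<open>\<iota>\<^sup>* e\<^sub>i\<^sup>*\<close> yields the \<open>i\<close>-th coordinate.\<close>

definition weight_character :: "(complex^'d) set \<Rightarrow> (real^'d \<Rightarrow> real) \<Rightarrow> complex^'d \<Rightarrow> complex" where
  "weight_character M \<alpha> \<zeta> =
     (THE c. \<exists>w\<in>lie_algebra_complex M.
        \<zeta> = torus_exp w \<and> c = exp (2 * of_real pi * \<i> * complexify \<alpha> w))"

definition polynomial_on_Cd :: "(complex^'d \<Rightarrow> complex) \<Rightarrow> bool" where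
  "polynomial_on_Cd f \<longleftrightarrow>
     (\<exists>(S :: ('d \<Rightarrow> nat) set) c. finite S \<and>
        f = (\<lambda>p. \<Sum>a\<in>S. c a * (\<Prod>i\<in>UNIV. (p $ i) ^ a i)))"

definition nonneg_cone :: "(complex^'d) set \<Rightarrow> complex^'d \<Rightarrow> (real^'d \<Rightarrow> real) set" where
  "nonneg_cone M z =
     {(\<lambda>\<xi>\<in>lie_algebra M. \<Sum>i\<in>UNIV. c i * (cmod (z $ i))\<^sup>2 * iota_star M (e_star i) \<xi>)
      | c :: 'd \<Rightarrow> real. \<forall>i. c i \<ge> 0}"

definition pos_cone :: "(complex^'d) set \<Rightarrow> complex^'d \<Rightarrow> (real^'d \<Rightarrow> real) set" where
  "pos_cone M z =
     {(\<lambda>\<xi>\<in>lie_algebra M. \<Sum>i\<in>UNIV. c i * (cmod (z $ i))\<^sup>2 * iota_star M (e_star i) \<xi>)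
      | c :: 'd \<Rightarrow> real. \<forall>i. c i > 0}"

text \<open>For integral weights, semi-stability is defined by equivariant polynomials. For other
  \<open>\<alpha>\<close> there is no character, and the cone condition is taken as the definition.\<close>

definition semistable :: "(complex^'d) set \<Rightarrow> (real^'d \<Rightarrow> real) \<Rightarrow> complex^'d \<Rightarrow> bool" where
  "semistable M \<alpha> z \<longleftrightarrow>
     (if \<alpha> \<in> integral_weights M
      then \<exists>k::nat. \<exists>f. k > 0 \<and> polynomial_on_Cd f \<and>
             (\<forall>p. \<forall>\<zeta>\<in>complexification M. f (p * \<zeta>) = f p * weight_character M \<alpha> \<zeta> ^ k) \<and>
             f z \<noteq> 0
      else \<alpha> \<in> nonneg_cone M z)"

definition semistable_points :: "(complex^'d) set \<Rightarrow> (real^'d \<Rightarrow> real) \<Rightarrow> (complex^'d) set" where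
  "semistable_points M \<alpha> = {z. semistable M \<alpha> z}"

definition torus_orbit :: "(complex^'d) set \<Rightarrow> complex^'d \<Rightarrow> (complex^'d) set" where
  "torus_orbit M z = (\<lambda>\<zeta>. z * \<zeta>) ` complexification M"

lemma torus_exp_add: "torus_exp (v + w) = torus_exp v * torus_exp w"
  by (simp add: torus_exp_def vec_eq_iff exp_add[symmetric] algebra_simps)

lemma real_vec_add: "real_vec (x + y) = real_vec x + real_vec y"
  by (simp add: real_vec_def vec_eq_iff)

lemma lie_algebra_diff:
  assumes "subtorus M" "x \<in> lie_algebra M" "y \<in> lie_algebra M"
  shows "x - y \<in> lie_algebra M"
proof -
  have "torus_exp (real_vec (t *\<^sub>R (x - y))) \<in> M" for t
  proof -
    have "t *\<^sub>R (x - y) = t *\<^sub>R x + (- t) *\<^sub>R y"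
      by (simp add: algebra_simps)
    then have "torus_exp (real_vec (t *\<^sub>R (x - y)))
        = torus_exp (real_vec (t *\<^sub>R x)) * torus_exp (real_vec ((- t) *\<^sub>R y))"
      by (simp only: real_vec_add torus_exp_add)
    moreover have "torus_exp (real_vec (t *\<^sub>R x)) \<in> M"
        "torus_exp (real_vec ((- t) *\<^sub>R y)) \<in> M"
      using assms(2,3) unfolding lie_algebra_def by blast+
    ultimately show ?thesis
      using assms(1) unfolding subtorus_def by metis
  qed
  then show ?thesis by (simp add: lie_algebra_def)
qed

lemma weight_character_torus_exp:
  assumes M: "subtorus M" and \<alpha>: "\<alpha> \<in> integral_weights M" and w: "w \<in> lie_algebra_complex M"
  shows "weight_character M \<alpha> (torus_exp w) = exp (2 * of_real pi * \<i> * complexify \<alpha> w)"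
  unfolding weight_character_def
proof (rule the_equality)
  show "\<exists>v\<in>lie_algebra_complex M. torus_exp w = torus_exp v \<and>
     exp (2 * of_real pi * \<i> * complexify \<alpha> w) = exp (2 * of_real pi * \<i> * complexify \<alpha> v)"
    using w by blast
next
  fix c assume "\<exists>v\<in>lie_algebra_complex M. torus_exp w = torus_exp v \<and>
     c = exp (2 * of_real pi * \<i> * complexify \<alpha> v)"
  then obtain v where v: "v \<in> lie_algebra_complex M" "torus_exp w = torus_exp v"
    and c: "c = exp (2 * of_real pi * \<i> * complexify \<alpha> v)" by blast
  have "\<exists>n::int. w $ i = v $ i + of_int n" for i
  proof -
    have "exp (2 * of_real pi * \<i> * w $ i) = exp (2 * of_real pi * \<i> * v $ i)"
      using v(2) by (simp add: torus_exp_def vec_eq_iff)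
    then obtain n :: int where
      "2 * of_real pi * \<i> * w $ i = 2 * of_real pi * \<i> * v $ i + (of_int (2 * n) * pi) * \<i>"
      unfolding exp_eq by blast
    then have "(2 * of_real pi * \<i>) * (w $ i) = (2 * of_real pi * \<i>) * (v $ i + of_int n)"
      by (simp add: algebra_simps)
    then show ?thesis by (metis mult_cancel_left complex_i_not_zero mult_eq_0_iff
        of_real_eq_0_iff pi_neq_zero zero_neq_numeral)
  qed
  then obtain n :: "'a \<Rightarrow> int" where n: "\<And>i. w $ i = v $ i + of_int (n i)" by metis
  have im: "Im_vec w = Im_vec v" by (simp add: Im_vec_def vec_eq_iff n)
  define \<delta> where "\<delta> = Re_vec w - Re_vec v"
  have \<delta>: "\<delta> \<in> lie_algebra M"
    using v(1) w lie_algebra_diff[OF M] unfolding \<delta>_def lie_algebra_complex_def by blast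
  have "\<delta> $ i = of_int (n i)" for i by (simp add: \<delta>_def Re_vec_def n)
  then have "torus_exp (real_vec \<delta>) = 1"
    by (simp add: torus_exp_def real_vec_def vec_eq_iff exp_eq_1)
  then have int: "\<alpha> \<delta> \<in> \<int>" using \<alpha> \<delta> unfolding integral_weights_def by blast
  then obtain k where k: "\<alpha> \<delta> = of_int k" by (auto elim: Ints_cases)
  have "Re_vec w = Re_vec v + \<delta>" by (simp add: \<delta>_def)
  then have "\<alpha> (Re_vec w) = \<alpha> (Re_vec v) + of_int k"
    using \<alpha> \<delta> v(1) k unfolding integral_weights_def dual_space_def lie_algebra_complex_def by auto
  then have "2 * of_real pi * \<i> * complexify \<alpha> w
      = 2 * of_real pi * \<i> * complexify \<alpha> v + (of_int (2 * k) * pi) * \<i>"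
    by (simp add: complexify_def im algebra_simps)
  then show "c = exp (2 * of_real pi * \<i> * complexify \<alpha> w)"
    unfolding c by (metis exp_eq)
qed

lemma iota_star_e_star_integral:
  assumes "subtorus M"
  shows "iota_star M (e_star i) \<in> integral_weights M"
proof -
  have add: "x + y \<in> lie_algebra M" if "x \<in> lie_algebra M" "y \<in> lie_algebra M" for x y
  proof -
    have "0 \<in> lie_algebra M" using lie_algebra_diff[OF assms that(1) that(1)] by simp
    from lie_algebra_diff[OF assms that(1) lie_algebra_diff[OF assms this that(2)]]
    show ?thesis by simp
  qed
  have scale: "c *\<^sub>R x \<in> lie_algebra M" if "x \<in> lie_algebra M" for c x
    using that by (simp add: lie_algebra_def)
  have "\<xi> $ i \<in> \<int>" if "torus_exp (real_vec \<xi>) = 1" for \<xi> :: "real^'a"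
  proof -
    have "exp (2 * of_real pi * \<i> * of_real (\<xi> $ i)) = (1::complex)"
      using that by (simp add: torus_exp_def real_vec_def vec_eq_iff)
    then show ?thesis by (auto simp: exp_eq_1)
  qed
  then show ?thesis
    by (auto simp: integral_weights_def dual_space_def iota_star_def e_star_def add scale)
qed

lemma weight_character_iota_star_e_star:
  assumes "subtorus M" "\<zeta> \<in> complexification M"
  shows "weight_character M (iota_star M (e_star i)) \<zeta> = \<zeta> $ i"
proof -
  from assms(2) obtain w where w: "w \<in> lie_algebra_complex M" "\<zeta> = torus_exp w"
    unfolding complexification_def by blast
  have "complexify (iota_star M (e_star i)) w = w $ i"
    using w(1) by (simp add: complexify_def iota_star_def e_star_def lie_algebra_complex_def
        Re_vec_def Im_vec_def complex_eq[symmetric])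
  then show ?thesis
    using weight_character_torus_exp[OF assms(1) iota_star_e_star_integral[OF assms(1)] w(1)] w(2)
    by (simp add: torus_exp_def)
qed

end

theory Submission
  imports Defs "HOL-Analysis.Kronecker_Approximation_Theorem"
begin

text \<open>
  Write \<open>V\<close> for the Lie algebra of \<open>M\<close>, a subspace of \<open>\<real>\<^sup>d\<close>, and \<open>I\<close> for the support of \<open>z\<close>.
  Rescaling the coefficients by the numbers \<open>\<bar>z\<^sub>i\<bar>\<^sup>2\<close>, which are positive exactly for \<open>i \<in> I\<close>, shows
  that both cone conditions depend on \<open>z\<close> only through \<open>I\<close>: they ask for coefficients
  \<open>c\<^sub>i \<ge> 0\<close>, respectively \<open>c\<^sub>i > 0\<close>, with \<open>\<alpha>(\<xi>) = (\<Sum>i\<in>I. c\<^sub>i \<xi>\<^sub>i)\<close> for all \<open>\<xi> \<in> V\<close>. The direction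
  \<open>\<i> t \<xi>\<close> with \<open>\<xi> \<in> V\<close> acts on \<open>z\<^sub>i\<close> by the real factor \<open>exp (- 2 \<pi> t \<xi>\<^sub>i)\<close>, and the whole proof
  compares the size of these factors with the pairing \<open>\<alpha>(\<xi>)\<close>.

  First part. Only integral \<open>\<alpha>\<close> need an argument, as the cone condition is the definition for
  the others. If \<open>\<alpha>\<close> is integral and not in the cone, Farkas' lemma
  (\<open>not_nonneg_rep_separation\<close>) gives \<open>\<xi> \<in> V\<close> with \<open>\<xi>\<^sub>i \<ge> 0\<close> on \<open>I\<close> and \<open>\<alpha>(\<xi>) < 0\<close>. Along this
  direction \<open>z\<close> stays bounded while an equivariant polynomial grows by the factor
  \<open>exp (- 2 \<pi> k t \<alpha>(\<xi>))\<close>, so it vanishes at \<open>z\<close>. Conversely, if \<open>\<alpha>\<close> is in the cone, the wanted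
  polynomial is a monomial; one has to replace the real coefficients by natural numbers after
  multiplying \<open>\<alpha>\<close> by some \<open>k\<close>. Here it matters that \<open>M\<close> is closed: \<open>V\<close> is then spanned by
  integer vectors (\<open>lie_algebra_eq_span_integer_vectors\<close>). On an integral basis \<open>\<alpha>\<close> has integer
  values, and if the numbers \<open>k c\<^sub>i\<close> are all very close to integers \<open>n\<^sub>i\<close>, then
  \<open>k \<alpha>(b) - (\<Sum>i\<in>I. n\<^sub>i b\<^sub>i)\<close> is an integer of absolute value below 1, hence zero
  (\<open>nonneg_rep_integer_multiple\<close>).

  Second part. If \<open>\<alpha>\<close> is in the closed cone but not in the open one, a second application of
  Farkas' lemma (\<open>not_pos_rep_separation\<close>) yields \<open>\<xi> \<in> V\<close> with \<open>\<xi>\<^sub>i \<ge> 0\<close> on \<open>I\<close>, not all zero, and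
  \<open>\<alpha>(\<xi>) \<le> 0\<close>. Flowing along it kills the coordinates with \<open>\<xi>\<^sub>i > 0\<close>; the limit is still
  semi-stable, lies in the closure of the orbit and has smaller support, so the orbit is not
  closed. Conversely, let all \<open>c\<^sub>i\<close> be positive and let a sequence in the orbit, with imaginary
  directions \<open>y\<^sub>n \<in> V\<close>, converge to a semi-stable point \<open>q\<close>. Were some coordinate in \<open>I\<close> lost in the limit,
  then \<open>\<alpha>(y\<^sub>n)\<close> computed with the \<open>c\<^sub>i\<close> would contain terms tending to infinity, while computed from the
  representation at \<open>q\<close> it only involves convergent coordinates (\<open>exponential_limit_nonzero\<close>).
  So all coordinates of \<open>y\<^sub>n\<close> in \<open>I\<close> converge, and as the real directions may be chosen in
  a compact fundamental domain of \<open>V\<close>, \<open>q\<close> lies on the orbit.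
\<close>

section \<open>Cones of coordinate functionals and Farkas' lemma\<close>

text \<open>Functionals on \<open>V\<close> are represented by vectors \<open>a\<close> through the inner product; \<open>a\<close> matters only up
  to the orthogonal complement of \<open>V\<close>. The condition says that \<open>a\<close>, restricted to \<open>V\<close>, lies in the cone
  generated by the coordinate functionals in \<open>I\<close>; \<open>pos_rep\<close> below is the relative interior of
  that cone.\<close>

definition nonneg_rep :: "(real^'d) set \<Rightarrow> 'd set \<Rightarrow> real^'d \<Rightarrow> bool" where
  "nonneg_rep V I a \<longleftrightarrow> (\<exists>c. (\<forall>i\<in>I. 0 \<le> c i) \<and> (\<forall>\<xi>\<in>V. a \<bullet> \<xi> = (\<Sum>i\<in>I. c i * \<xi> $ i)))"

definition pos_rep :: "(real^'d) set \<Rightarrow> 'd set \<Rightarrow> real^'d \<Rightarrow> bool" where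
  "pos_rep V I a \<longleftrightarrow> (\<exists>c. (\<forall>i\<in>I. 0 < c i) \<and> (\<forall>\<xi>\<in>V. a \<bullet> \<xi> = (\<Sum>i\<in>I. c i * \<xi> $ i)))"

lemma orthogonal_projection_exists:
  fixes V :: "'a::euclidean_space set"
  assumes "subspace V"
  obtains p where "\<And>x. p x \<in> V" "\<And>x \<xi>. \<xi> \<in> V \<Longrightarrow> p x \<bullet> \<xi> = x \<bullet> \<xi>"
proof -
  have "\<exists>y. y \<in> V \<and> (\<forall>\<xi>\<in>V. y \<bullet> \<xi> = x \<bullet> \<xi>)" for x
  proof -
    obtain y w where "y \<in> span V" "\<And>v. v \<in> span V \<Longrightarrow> orthogonal w v" "x = y + w"
      using orthogonal_subspace_decomp_exists[of V x] by metis
    then show ?thesis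
      unfolding span_eq_iff[THEN iffD2, OF assms] by (intro exI[of _ y]) (auto simp: orthogonal_def inner_add_left)
  qed
  then show ?thesis using that by metis
qed

text \<open>After projecting orthogonally to \<open>V\<close>, this is the usual argument: the cone generated by
  finitely many vectors is closed, so a vector outside it is strictly separated from it, and
  the separating vector, projected to \<open>V\<close>, contradicts the hypothesis.\<close>

lemma farkas_on_subspace:
  fixes V :: "'a::euclidean_space set" and u :: "'i \<Rightarrow> 'a"
  assumes V: "subspace V" and I: "finite I"
    and imp: "\<And>\<xi>. \<xi> \<in> V \<Longrightarrow> \<forall>i\<in>I. 0 \<le> u i \<bullet> \<xi> \<Longrightarrow> 0 \<le> a \<bullet> \<xi>"
  shows "\<exists>c. (\<forall>i\<in>I. 0 \<le> c i) \<and> (\<forall>\<xi>\<in>V. a \<bullet> \<xi> = (\<Sum>i\<in>I. c i * (u i \<bullet> \<xi>)))"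
proof -
  obtain p where pV: "\<And>x. p x \<in> V" and p: "\<And>x \<xi>. \<xi> \<in> V \<Longrightarrow> p x \<bullet> \<xi> = x \<bullet> \<xi>"
    using orthogonal_projection_exists[OF V] by metis
  define H where "H = convex_cone hull ((\<lambda>i. p (u i)) ` I)"
  have "p a \<in> H"
  proof (rule ccontr)
    assume "p a \<notin> H"
    moreover have "closed H" "convex H"
      using I by (simp_all add: H_def closed_convex_cone_hull convex_convex_cone_hull)
    ultimately obtain w b where w: "w \<bullet> p a < b" and b: "\<And>s. s \<in> H \<Longrightarrow> b < w \<bullet> s"
      by (metis separating_hyperplane_closed_point)
    \<comment> \<open>The cone contains 0, so the bound is negative; being closed under scaling, the cone
      then lies in the half-space where \<open>w\<close> is nonnegative.\<close>
    have "b < 0" using b[of 0] by (simp add: H_def convex_cone_hull_contains_0)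
    have pos: "0 \<le> w \<bullet> s" if s: "s \<in> H" for s
    proof (rule ccontr)
      assume neg: "\<not> 0 \<le> w \<bullet> s"
      have "(b / (w \<bullet> s)) *\<^sub>R s \<in> H"
        using s neg \<open>b < 0\<close> unfolding H_def by (intro convex_cone_hull_mul) (auto simp: divide_simps)
      from b[OF this] neg show False by simp
    qed
    have sym: "x \<bullet> p w = w \<bullet> p x" for x
      using p[OF pV, of x w] p[OF pV, of w x] by (simp add: inner_commute)
    have "0 \<le> u i \<bullet> p w" if "i \<in> I" for i
      unfolding sym using that by (intro pos) (simp add: H_def hull_inc)
    then have "0 \<le> a \<bullet> p w" using imp[OF pV] by blast
    with w \<open>b < 0\<close> show False by (simp add: sym)
  qed
  moreover have "H \<subseteq> {\<Sum>i\<in>I. c i *\<^sub>R p (u i) | c. \<forall>i\<in>I. 0 \<le> c i}" (is "_ \<subseteq> ?C")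
    unfolding H_def
  proof (rule hull_minimal)
    show "(\<lambda>i. p (u i)) ` I \<subseteq> ?C"
    proof clarify
      fix j assume "j \<in> I"
      then show "\<exists>c. p (u j) = (\<Sum>i\<in>I. c i *\<^sub>R p (u i)) \<and> (\<forall>i\<in>I. 0 \<le> c i)"
        using I by (intro exI[of _ "\<lambda>i. if i = j then 1 else 0"])
          (simp add: if_distrib[of "\<lambda>r. r *\<^sub>R _"] cong: if_cong)
    qed
    show "convex_cone ?C"
      unfolding convex_cone_iff
    proof (intro conjI ballI allI impI)
      show "0 \<in> ?C" by (rule CollectI, rule exI[of _ "\<lambda>_. 0"]) simp
    next
      fix x y assume "x \<in> ?C" "y \<in> ?C"
      then obtain c c' where "x = (\<Sum>i\<in>I. c i *\<^sub>R p (u i))" "\<forall>i\<in>I. 0 \<le> c i"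
        "y = (\<Sum>i\<in>I. c' i *\<^sub>R p (u i))" "\<forall>i\<in>I. 0 \<le> c' i" by blast
      then show "x + y \<in> ?C"
        by (intro CollectI exI[of _ "\<lambda>i. c i + c' i"]) (simp add: scaleR_add_left sum.distrib)
    next
      fix x and r :: real assume "x \<in> ?C" "0 \<le> r"
      then obtain c where "x = (\<Sum>i\<in>I. c i *\<^sub>R p (u i))" "\<forall>i\<in>I. 0 \<le> c i" by blast
      then show "r *\<^sub>R x \<in> ?C"
        using \<open>0 \<le> r\<close> by (intro CollectI exI[of _ "\<lambda>i. r * c i"]) (simp add: scaleR_sum_right)
    qed
  qed
  ultimately obtain c where c: "\<forall>i\<in>I. 0 \<le> c i" "p a = (\<Sum>i\<in>I. c i *\<^sub>R p (u i))" by blast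
  have "a \<bullet> \<xi> = (\<Sum>i\<in>I. c i * (u i \<bullet> \<xi>))" if "\<xi> \<in> V" for \<xi>
    unfolding p[OF that, of a, symmetric] c(2) by (simp add: inner_sum_left p[OF that])
  with c(1) show ?thesis by blast
qed

lemma not_nonneg_rep_separation:
  fixes V :: "(real^'d) set"
  assumes V: "subspace V" and not: "\<not> nonneg_rep V I a"
  obtains \<xi> where "\<xi> \<in> V" "\<forall>i\<in>I. 0 \<le> \<xi> $ i" "a \<bullet> \<xi> < 0"
proof -
  have "\<exists>\<xi>\<in>V. (\<forall>i\<in>I. 0 \<le> \<xi> $ i) \<and> a \<bullet> \<xi> < 0"
  proof (rule ccontr)
    assume "\<not> ?thesis"
    then have "\<exists>c. (\<forall>i\<in>I. 0 \<le> c i) \<and> (\<forall>\<xi>\<in>V. a \<bullet> \<xi> = (\<Sum>i\<in>I. c i * (axis i 1 \<bullet> \<xi>)))"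
      by (intro farkas_on_subspace[OF V]) (force simp: inner_axis' not_less)+
    then show False using not by (simp add: nonneg_rep_def inner_axis')
  qed
  then show ?thesis using that by blast
qed

text \<open>The functional \<open>a\<close> has a representation with \<open>c j > 0\<close> as soon as minus the \<open>j\<close>-th coordinate
  lies in the cone generated by \<open>- a\<close> and the coordinates in \<open>I\<close>: adding the given
  representation of \<open>a\<close> to such a relation and dividing by the total multiple of \<open>a\<close> does it. The
  hypothesis \<open>no\<close> is the Farkas condition for the enlarged set of generators.\<close>

lemma nonneg_rep_pos_at_or_separation:
  fixes V :: "(real^'d) set"
  assumes V: "subspace V" and rep: "nonneg_rep V I a" and j: "j \<in> I"
    and no: "\<And>\<xi>. \<xi> \<in> V \<Longrightarrow> \<forall>i\<in>I. 0 \<le> \<xi> $ i \<Longrightarrow> a \<bullet> \<xi> \<le> 0 \<Longrightarrow> \<xi> $ j \<le> 0"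
  shows "\<exists>c. (\<forall>i\<in>I. 0 \<le> c i) \<and> 0 < c j \<and> (\<forall>\<xi>\<in>V. a \<bullet> \<xi> = (\<Sum>i\<in>I. c i * \<xi> $ i))"
proof -
  have fin: "finite I" by simp
  obtain c0 where c0: "\<forall>i\<in>I. 0 \<le> c0 i" "\<And>\<xi>. \<xi> \<in> V \<Longrightarrow> a \<bullet> \<xi> = (\<Sum>i\<in>I. c0 i * \<xi> $ i)"
    using rep unfolding nonneg_rep_def by blast
  \<comment> \<open>The index \<open>None\<close> stands for the extra generator \<open>- a\<close>.\<close>
  define u where "u = case_option (- a) (\<lambda>i. axis i (1::real))"
  have u: "u None \<bullet> \<xi> = - (a \<bullet> \<xi>)" "u (Some i) \<bullet> \<xi> = \<xi> $ i" for \<xi> i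
    by (simp_all add: u_def inner_axis')
  have "\<exists>d. (\<forall>k\<in>insert None (Some ` I). 0 \<le> d k) \<and>
      (\<forall>\<xi>\<in>V. - axis j 1 \<bullet> \<xi> = (\<Sum>k\<in>insert None (Some ` I). d k * (u k \<bullet> \<xi>)))"
  proof (rule farkas_on_subspace[OF V])
    fix \<xi> assume \<xi>: "\<xi> \<in> V" "\<forall>k\<in>insert None (Some ` I). 0 \<le> u k \<bullet> \<xi>"
    then show "0 \<le> - axis j 1 \<bullet> \<xi>" using no[of \<xi>] by (simp add: u inner_axis')
  qed (use fin in simp)
  then obtain d where d: "\<forall>k\<in>insert None (Some ` I). 0 \<le> d k"
      "\<forall>\<xi>\<in>V. - axis j 1 \<bullet> \<xi> = (\<Sum>k\<in>insert None (Some ` I). d k * (u k \<bullet> \<xi>))" by blast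
  have eq: "d None * (a \<bullet> \<xi>) = \<xi> $ j + (\<Sum>i\<in>I. d (Some i) * \<xi> $ i)" if "\<xi> \<in> V" for \<xi>
    using bspec[OF d(2) that] fin by (simp add: inner_axis' u sum.reindex)
  define t where "t = 1 / (1 + d None)"
  have t: "0 < t" "t * (1 + d None) = 1" using d(1) by (auto simp: t_def add_pos_nonneg)
  let ?c = "\<lambda>i. t * (c0 i + d (Some i) + (if i = j then 1 else 0))"
  have "a \<bullet> \<xi> = (\<Sum>i\<in>I. ?c i * \<xi> $ i)" if \<xi>: "\<xi> \<in> V" for \<xi>
  proof -
    have "(\<Sum>i\<in>I. ?c i * \<xi> $ i) = t * (\<Sum>i\<in>I. c0 i * \<xi> $ i + d (Some i) * \<xi> $ i + (if i = j then \<xi> $ i else 0))"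
      unfolding sum_distrib_left by (intro sum.cong) (auto simp: algebra_simps)
    also have "\<dots> = t * (a \<bullet> \<xi> + d None * (a \<bullet> \<xi>))"
      using j fin by (simp only: sum.distrib eq[OF \<xi>] c0(2)[OF \<xi>, symmetric] sum.delta if_True add_ac)
    also have "\<dots> = (t * (1 + d None)) * (a \<bullet> \<xi>)" by (simp add: algebra_simps)
    finally show ?thesis by (simp add: t)
  qed
  moreover have "0 \<le> ?c i" if "i \<in> I" for i
    using that c0(1) d(1) t(1) by (auto intro!: mult_nonneg_nonneg add_nonneg_nonneg)
  moreover have "0 < ?c j"
    using j c0(1) d(1) t(1) by (auto intro!: mult_pos_pos add_nonneg_pos add_nonneg_nonneg)
  ultimately show ?thesis by (intro exI[of _ ?c]) blast
qed

text \<open>The average over \<open>j\<close> of representations of \<open>a\<close> that are positive at \<open>j\<close> is positive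
  everywhere, so some \<open>j\<close> admits no such representation.\<close>

lemma not_pos_rep_separation:
  fixes V :: "(real^'d) set"
  assumes V: "subspace V" and rep: "nonneg_rep V I a" and not: "\<not> pos_rep V I a"
  obtains \<xi> j where "\<xi> \<in> V" "\<forall>i\<in>I. 0 \<le> \<xi> $ i" "a \<bullet> \<xi> \<le> 0" "j \<in> I" "0 < \<xi> $ j"
proof -
  have "\<exists>\<xi>\<in>V. \<exists>j\<in>I. (\<forall>i\<in>I. 0 \<le> \<xi> $ i) \<and> a \<bullet> \<xi> \<le> 0 \<and> 0 < \<xi> $ j"
  proof (rule ccontr)
    assume no: "\<not> ?thesis"
    have "\<forall>j\<in>I. \<exists>c. (\<forall>i\<in>I. 0 \<le> c i) \<and> 0 < c j \<and> (\<forall>\<xi>\<in>V. a \<bullet> \<xi> = (\<Sum>i\<in>I. c i * \<xi> $ i))"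
      using no by (intro ballI nonneg_rep_pos_at_or_separation[OF V rep]) (auto simp: not_less)
    then obtain c where c: "\<And>i j. j \<in> I \<Longrightarrow> i \<in> I \<Longrightarrow> 0 \<le> c j i" "\<And>j. j \<in> I \<Longrightarrow> 0 < c j j"
        "\<And>j \<xi>. j \<in> I \<Longrightarrow> \<xi> \<in> V \<Longrightarrow> a \<bullet> \<xi> = (\<Sum>i\<in>I. c j i * \<xi> $ i)"
      by metis
    have fin: "finite I" by simp
    have "pos_rep V I a"
    proof (cases "I = {}")
      case True
      \<comment> \<open>Without coordinates there is nothing to average, and both conditions say that \<open>a\<close> vanishes
        on \<open>V\<close>.\<close>
      then show ?thesis using rep by (simp add: pos_rep_def nonneg_rep_def)
    next
      case False
      then have card: "real (card I) > 0" using fin by (simp add: card_gt_0_iff)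
      let ?c = "\<lambda>i. (\<Sum>j\<in>I. c j i) / card I"
      have "0 < ?c i" if "i \<in> I" for i
        using that card c(1,2) fin by (intro divide_pos_pos sum_pos2[of I i]) auto
      moreover have "a \<bullet> \<xi> = (\<Sum>i\<in>I. ?c i * \<xi> $ i)" if \<xi>: "\<xi> \<in> V" for \<xi>
      proof -
        have "(\<Sum>i\<in>I. ?c i * \<xi> $ i) = (\<Sum>i\<in>I. \<Sum>j\<in>I. c j i * \<xi> $ i) / card I"
          by (simp add: sum_divide_distrib sum_distrib_right)
        also have "(\<Sum>i\<in>I. \<Sum>j\<in>I. c j i * \<xi> $ i) = (\<Sum>j\<in>I. a \<bullet> \<xi>)"
          by (subst sum.swap) (simp add: c(3)[OF _ \<xi>])
        finally show ?thesis using card False by simp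
      qed
      ultimately show ?thesis unfolding pos_rep_def by (intro exI[of _ ?c]) blast
    qed
    with not show False ..
  qed
  then show ?thesis using that by blast
qed

section \<open>Closed subgroups and simultaneous approximation\<close>

text \<open>This is the linear case of Cartan's closed subgroup theorem. If small elements of \<open>G\<close>
  outside the largest subspace \<open>V\<close> of \<open>G\<close> existed, their components orthogonal to \<open>V\<close> would be
  small nonzero elements \<open>y n\<close> of \<open>G\<close>. Take a limit of their directions: integer multiples of the \<open>y n\<close>
  approximate every point of the line that it spans, so this line lies in the closed set \<open>G\<close>
  and hence in \<open>V\<close>, yet it is orthogonal to \<open>V\<close>.\<close>

lemma closed_subgroup_small_elements:
  fixes G :: "'a::euclidean_space set"
  assumes cl: "closed G" and G0: "0 \<in> G" and diff: "\<And>x y. x \<in> G \<Longrightarrow> y \<in> G \<Longrightarrow> x - y \<in> G"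
  obtains e where "0 < e" "\<And>x t. x \<in> G \<Longrightarrow> norm x < e \<Longrightarrow> t *\<^sub>R x \<in> G"
proof -
  have minus: "- x \<in> G" if "x \<in> G" for x using diff[OF G0 that] by simp
  have add: "x + y \<in> G" if "x \<in> G" "y \<in> G" for x y using diff[OF that(1) minus[OF that(2)]] by simp
  have natmult: "real n *\<^sub>R x \<in> G" if "x \<in> G" for x n
    by (induction n) (auto simp: G0 add that scaleR_add_left)
  have intmult: "real_of_int n *\<^sub>R x \<in> G" if "x \<in> G" for x n
    using natmult[OF that, of "nat n"] minus[OF natmult[OF that, of "nat (- n)"]]
    by (cases "n \<ge> 0") auto
  define V where "V = {x. \<forall>t. t *\<^sub>R x \<in> G}"
  have V: "subspace V"
    by (auto simp: subspace_def V_def G0 scaleR_add_right intro: add)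
  have "\<exists>e>0. \<forall>x\<in>G. norm x < e \<longrightarrow> x \<in> V"
  proof (rule ccontr)
    assume not: "\<not> ?thesis"
    have "\<exists>x\<in>G. norm x < 1 / real (Suc n) \<and> x \<notin> V" for n
      using not by (auto dest!: spec[of _ "1 / real (Suc n)"])
    then obtain x where x: "\<And>n. x n \<in> G" "\<And>n. norm (x n) < 1 / real (Suc n)" "\<And>n. x n \<notin> V"
      by metis
    have "\<exists>y. y \<in> G \<and> y \<noteq> 0 \<and> norm y < 1 / real (Suc n) \<and> (\<forall>v\<in>V. y \<bullet> v = 0)" for n
    proof -
      obtain v y where vy: "v \<in> span V" "\<And>w. w \<in> span V \<Longrightarrow> orthogonal y w" "x n = v + y"
        using orthogonal_subspace_decomp_exists[of V "x n"] by metis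
      have vV: "v \<in> V" using vy(1) unfolding span_eq_iff[THEN iffD2, OF V] .
      then have "v \<in> G" using scaleR_one[of v] unfolding V_def by (metis (mono_tags) mem_Collect_eq)
      then have "y \<in> G" using diff[OF x(1)[of n]] vy(3) by (metis add_diff_cancel_left')
      moreover have "y \<noteq> 0" using x(3)[of n] vy(3) vV by auto
      moreover have "(norm (x n))\<^sup>2 = (norm v)\<^sup>2 + (norm y)\<^sup>2"
        unfolding vy(3) using vy(2)[OF vy(1)]
        by (intro norm_add_Pythagorean) (simp add: orthogonal_def inner_commute)
      then have "norm y \<le> norm (x n)" by (simp add: power2_le_imp_le)
      moreover have "\<forall>v\<in>V. y \<bullet> v = 0" using vy(2) by (auto simp: orthogonal_def span_base)
      ultimately show ?thesis using x(2)[of n] by (intro exI[of _ y]) auto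
    qed
    then obtain y where "\<forall>n. y n \<in> G \<and> y n \<noteq> 0 \<and> norm (y n) < 1 / real (Suc n) \<and> (\<forall>v\<in>V. y n \<bullet> v = 0)"
      using choice[of "\<lambda>n y. y \<in> G \<and> y \<noteq> 0 \<and> norm y < 1 / real (Suc n) \<and> (\<forall>v\<in>V. y \<bullet> v = 0)"] by blast
    then have y: "\<And>n. y n \<in> G" "\<And>n. y n \<noteq> 0" "\<And>n. norm (y n) < 1 / real (Suc n)"
        "\<And>n v. v \<in> V \<Longrightarrow> y n \<bullet> v = 0" by blast+
    have y0: "(\<lambda>n. norm (y n)) \<longlonglongrightarrow> 0"
      by (rule tendsto_sandwich[OF _ _ tendsto_const LIMSEQ_Suc[OF lim_1_over_n]])
        (use y(3) in \<open>auto intro!: always_eventually less_imp_le simp del: of_nat_Suc\<close>)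
    define u where "u n = (1 / norm (y n)) *\<^sub>R y n" for n
    have "u n \<in> sphere 0 1" for n using y(2) by (simp add: u_def)
    then obtain l r where l: "l \<in> sphere 0 1" and r: "strict_mono r" "(u \<circ> r) \<longlonglongrightarrow> l"
      using compact_imp_seq_compact[OF compact_sphere[of "0::'a" 1]] by (meson seq_compactE)
    have ur: "(\<lambda>n. u (r n)) \<longlonglongrightarrow> l" using r(2) by (simp add: o_def)
    have yr: "(\<lambda>n. norm (y (r n))) \<longlonglongrightarrow> 0" using LIMSEQ_subseq_LIMSEQ[OF y0 r(1)] by (simp add: o_def)
    have "t *\<^sub>R l \<in> G" for t
    proof -
      \<comment> \<open>Integer multiples of \<open>y (r n)\<close> approximate \<open>t *\<^sub>R u (r n)\<close> up to the length of \<open>y (r n)\<close>.\<close>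
      define g where "g n = of_int \<lfloor>t / norm (y (r n))\<rfloor> *\<^sub>R y (r n)" for n
      have "norm (t *\<^sub>R u (r n) - g n) \<le> norm (y (r n))" for n
      proof -
        have "t *\<^sub>R u (r n) - g n = frac (t / norm (y (r n))) *\<^sub>R y (r n)"
          by (simp add: u_def g_def frac_def algebra_simps)
        then show ?thesis using frac_lt_1[of "t / norm (y (r n))"]
          by (simp add: mult_left_le_one_le frac_ge_0 less_imp_le)
      qed
      then have "(\<lambda>n. t *\<^sub>R u (r n) - g n) \<longlonglongrightarrow> 0"
        by (intro Lim_null_comparison[OF _ yr] always_eventually) auto
      then have "(\<lambda>n. t *\<^sub>R u (r n) - (t *\<^sub>R u (r n) - g n)) \<longlonglongrightarrow> t *\<^sub>R l - 0"
        by (intro tendsto_intros ur)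
      then have "g \<longlonglongrightarrow> t *\<^sub>R l" by simp
      then show ?thesis
        using closed_sequentially[OF cl, of g] intmult[OF y(1)] by (auto simp: g_def)
    qed
    then have "l \<in> V" by (simp add: V_def)
    have "(\<lambda>n. u (r n) \<bullet> l) \<longlonglongrightarrow> l \<bullet> l" by (intro tendsto_intros ur)
    moreover have "u (r n) \<bullet> l = 0" for n using y(4)[OF \<open>l \<in> V\<close>] by (simp add: u_def)
    ultimately have "l \<bullet> l = 0" by (simp add: LIMSEQ_const_iff)
    with l show False by simp
  qed
  then show ?thesis using that unfolding V_def by blast
qed

text \<open>Dirichlet's theorem, transported from initial segments of the natural numbers to an
  arbitrary finite index type.\<close>

lemma simultaneous_approximation:
  fixes \<theta> :: "'d::finite \<Rightarrow> real"
  assumes "0 < e"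
  obtains q :: nat and p :: "'d \<Rightarrow> int" where "0 < q" "\<And>i. \<bar>real q * \<theta> i - of_int (p i)\<bar> < e"
proof -
  obtain h :: "nat \<Rightarrow> 'd" where h: "bij_betw h {0..<CARD('d)} UNIV"
    using ex_bij_betw_nat_finite[of "UNIV :: 'd set"] by auto
  obtain N where N: "N \<noteq> 0" "1 / real N < e"
    using assms real_arch_inverse[of e] by (auto simp: inverse_eq_divide)
  obtain q p where q: "0 < q"
    and p: "\<And>i. i < CARD('d) \<Longrightarrow> \<bar>of_int q * \<theta> (h i) - of_int (p i)\<bar> < 1 / N"
    using Dirichlet_approx_simult[of N "CARD('d)" "\<lambda>i. \<theta> (h i)"] N(1)
    by (metis gr0I)
  define g where "g = the_inv_into {0..<CARD('d)} h"
  have g: "g i < CARD('d)" "h (g i) = i" for i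
    using h the_inv_into_into[of h "{0..<CARD('d)}" i "{0..<CARD('d)}"] f_the_inv_into_f[of h "{0..<CARD('d)}" i]
    by (auto simp: g_def bij_betw_def)
  show ?thesis
  proof (rule that[of "nat q" "\<lambda>i. p (g i)"])
    show "\<bar>real (nat q) * \<theta> i - of_int (p (g i))\<bar> < e" for i
      using p[OF g(1)[of i]] N(2) q by (simp add: g(2))
  qed (use q in simp)
qed

section \<open>Integral representations\<close>

definition integer_vectors :: "(real^'d) set" where
  "integer_vectors = {x. \<forall>i. x $ i \<in> \<int>}"

text \<open>An integral functional in the real cone has a multiple in the semigroup generated by the
  coordinates. Approximate the coefficients \<open>c\<close> simultaneously by fractions \<open>p i / k\<close>. On an integral
  basis the error of the resulting representation is an integer of absolute value less than 1,
  so the representation is exact.\<close>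

lemma nonneg_rep_integer_multiple:
  fixes V :: "(real^'d) set"
  assumes V: "V = span (V \<inter> integer_vectors)"
    and int: "\<And>b. b \<in> V \<Longrightarrow> b \<in> integer_vectors \<Longrightarrow> a \<bullet> b \<in> \<int>"
    and rep: "nonneg_rep V I a"
  obtains k :: nat and n :: "'d \<Rightarrow> nat"
  where "0 < k" "\<And>\<xi>. \<xi> \<in> V \<Longrightarrow> real k * (a \<bullet> \<xi>) = (\<Sum>i\<in>I. real (n i) * \<xi> $ i)"
proof -
  obtain c where c: "\<forall>i\<in>I. 0 \<le> c i" "\<And>\<xi>. \<xi> \<in> V \<Longrightarrow> a \<bullet> \<xi> = (\<Sum>i\<in>I. c i * \<xi> $ i)"
    using rep unfolding nonneg_rep_def by metis
  obtain B where B: "B \<subseteq> V \<inter> integer_vectors" "independent B" "V \<inter> integer_vectors \<subseteq> span B"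
    by (rule maximal_independent_subset)
  have fin: "finite B" using B(2) by (rule independent_imp_finite)
  have VB: "V \<subseteq> span B" using V B(3) span_minimal[OF B(3) subspace_span] by simp
  \<comment> \<open>The bound \<open>1 / C\<close> makes the total error on each basis vector less than 1; as \<open>C \<ge> 1\<close>, it
    also keeps the approximating numerators above \<open>- 1\<close>, hence nonnegative.\<close>
  define C where "C = 1 + (\<Sum>b\<in>B. \<Sum>i\<in>I. \<bar>b $ i\<bar>)"
  have C: "1 \<le> C" by (simp add: C_def sum_nonneg)
  obtain k p where k: "0 < k" and p: "\<And>i. \<bar>real k * c i - of_int (p i)\<bar> < 1 / C"
    using simultaneous_approximation[of "1 / C" c] C by auto
  have pnn: "0 \<le> p i" if "i \<in> I" for i
  proof -
    have "1 / C \<le> 1" using C by simp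
    moreover have "0 \<le> real k * c i" using c(1) that by simp
    ultimately have "real_of_int (p i) > - 1" using p[of i] by linarith
    then show ?thesis by linarith
  qed
  have on_B: "real k * (a \<bullet> b) = (\<Sum>i\<in>I. of_int (p i) * b $ i)" if b: "b \<in> B" for b
  proof -
    let ?D = "real k * (a \<bullet> b) - (\<Sum>i\<in>I. of_int (p i) * b $ i)"
    have bV: "b \<in> V" "b \<in> integer_vectors" using B(1) b by auto
    have "?D \<in> \<int>"
      using int[OF bV] bV(2) by (intro Ints_diff Ints_mult Ints_sum) (auto simp: integer_vectors_def)
    moreover have "\<bar>?D\<bar> < 1"
    proof -
      have "?D = (\<Sum>i\<in>I. (real k * c i - of_int (p i)) * b $ i)"
        by (simp add: c(2)[OF bV(1)] sum_distrib_left sum_subtractf algebra_simps)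
      also have "\<bar>\<dots>\<bar> \<le> (\<Sum>i\<in>I. 1 / C * \<bar>b $ i\<bar>)"
        by (rule order_trans[OF sum_abs], rule sum_mono)
          (unfold abs_mult, intro mult_right_mono less_imp_le[OF p] abs_ge_zero)
      also have "\<dots> = (\<Sum>i\<in>I. \<bar>b $ i\<bar>) / C" by (simp add: sum_divide_distrib)
      also have "(\<Sum>i\<in>I. \<bar>b $ i\<bar>) \<le> C - 1"
        unfolding C_def using fin b member_le_sum[of b B "\<lambda>b. \<Sum>i\<in>I. \<bar>b $ i\<bar>"] by (simp add: sum_nonneg)
      then have "(\<Sum>i\<in>I. \<bar>b $ i\<bar>) / C < 1" using C by (simp add: divide_simps)
      finally show ?thesis .
    qed
    ultimately show ?thesis by (metis Ints_cases abs_less_iff eq_iff_diff_eq_0 Ints_nonzero_abs_less1)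
  qed
  have "real k * (a \<bullet> \<xi>) = (\<Sum>i\<in>I. real (nat (p i)) * \<xi> $ i)" if "\<xi> \<in> V" for \<xi>
  proof -
    have "\<xi> \<in> span B" using VB that by blast
    then have "real k * (a \<bullet> \<xi>) = (\<Sum>i\<in>I. of_int (p i) * \<xi> $ i)"
    proof (induction rule: span_induct_alt)
      case base
      then show ?case by simp
    next
      case (step r x y)
      then show ?case
        by (simp add: inner_add_right on_B distrib_left sum.distrib mult.left_commute flip: sum_distrib_left)
    qed
    also have "\<dots> = (\<Sum>i\<in>I. real (nat (p i)) * \<xi> $ i)"
      using pnn by (intro sum.cong) auto
    finally show ?thesis .
  qed
  then show ?thesis by (rule that[OF k])
qed

section \<open>The Lie algebra of a subtorus\<close>

text \<open>Elements of the dual space are only additive and homogeneous on \<open>V\<close>, so the functional is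
  first extended linearly from a basis.\<close>

lemma functional_is_inner:
  fixes V :: "(real^'d) set"
  assumes V: "subspace V" and \<alpha>: "\<alpha> \<in> dual_space V"
  obtains a where "\<And>\<xi>. \<xi> \<in> V \<Longrightarrow> \<alpha> \<xi> = a \<bullet> \<xi>"
proof -
  obtain B where B: "B \<subseteq> V" "independent B" "V \<subseteq> span B"
    by (rule maximal_independent_subset)
  obtain g where g: "linear g" "\<And>b. b \<in> B \<Longrightarrow> g b = \<alpha> b"
    using linear_independent_extend[OF B(2), of \<alpha>] by blast
  have add: "\<alpha> (x + y) = \<alpha> x + \<alpha> y" if "x \<in> V" "y \<in> V" for x y
    using \<alpha> that unfolding dual_space_def by blast
  have scale: "\<alpha> (r *\<^sub>R x) = r * \<alpha> x" if "x \<in> V" for r x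
    using \<alpha> that unfolding dual_space_def by blast
  have BV: "span B \<subseteq> V" using B(1) V by (rule span_minimal)
  have "\<alpha> \<xi> = adjoint g 1 \<bullet> \<xi>" if "\<xi> \<in> V" for \<xi>
  proof -
    have "\<xi> \<in> span B" using B(3) that by blast
    then have "\<xi> \<in> span B \<and> \<alpha> \<xi> = g \<xi>"
    proof (induction rule: span_induct_alt)
      case base
      then show ?case using scale[of 0 0] V by (simp add: span_zero subspace_0 linear_0[OF g(1)])
    next
      case (step r x y)
      have "x \<in> V" using step B(1) by blast
      moreover have "y \<in> V" "r *\<^sub>R x \<in> V" using step BV \<open>x \<in> V\<close> V by (auto simp: subspace_scale)
      ultimately show ?case
        using step g by (simp add: add scale linear_add linear_scale span_add span_scale span_base)
    qed
    then show ?thesis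
      using adjoint_works[OF g(1), of \<xi> 1] by (simp add: inner_commute)
  qed
  then show ?thesis by (rule that)
qed

lemma torus_exp_real_vec_cong:
  assumes "x - y \<in> integer_vectors"
  shows "torus_exp (real_vec x) = torus_exp (real_vec y)"
proof -
  have "torus_exp (real_vec x) $ i = torus_exp (real_vec y) $ i" for i
  proof -
    obtain n where n: "x $ i - y $ i = of_int n"
      using assms by (auto simp: integer_vectors_def elim: Ints_cases)
    then have "x $ i = y $ i + of_int n" by simp
    then show ?thesis
      by (simp add: torus_exp_def real_vec_def exp_eq algebra_simps)
  qed
  then show ?thesis by (simp add: vec_eq_iff)
qed

lemma continuous_on_torus_exp: "continuous_on UNIV torus_exp"
  unfolding torus_exp_def by (intro continuous_intros)

lemma continuous_on_real_vec: "continuous_on UNIV real_vec"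
  unfolding real_vec_def by (intro continuous_intros)

text \<open>The preimage of \<open>M\<close> in \<open>\<real>\<^sup>d\<close>, to which \<open>closed_subgroup_small_elements\<close> is applied below.\<close>

lemma torus_exp_real_vec_subgroup:
  assumes "subtorus M"
  defines "G \<equiv> {\<xi>. torus_exp (real_vec \<xi>) \<in> M}"
  shows "closed G" "0 \<in> G" "\<And>x y. x \<in> G \<Longrightarrow> y \<in> G \<Longrightarrow> x - y \<in> G"
proof -
  have "continuous_on UNIV (\<lambda>\<xi>. torus_exp (real_vec \<xi>))"
    using continuous_on_compose2[OF continuous_on_torus_exp continuous_on_real_vec] by simp
  moreover have "closed M" using assms(1) by (simp add: subtorus_def)
  ultimately have "closed ((\<lambda>\<xi>. torus_exp (real_vec \<xi>)) -` M)"
    by (intro closed_vimage)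
  then show "closed G" by (simp add: G_def vimage_def)
  have "torus_exp (real_vec 0) = 1" by (simp add: torus_exp_def real_vec_def vec_eq_iff)
  then show "0 \<in> G" using assms(1) unfolding G_def subtorus_def by (metis mem_Collect_eq)
  fix x y assume xy: "x \<in> G" "y \<in> G"
  have "torus_exp (real_vec (x - y)) = torus_exp (real_vec x) * (\<chi> i. inverse (torus_exp (real_vec y) $ i))"
    by (simp add: torus_exp_def real_vec_def vec_eq_iff algebra_simps flip: exp_minus exp_add)
  then show "x - y \<in> G"
    using xy assms(1) by (simp add: G_def subtorus_def)
qed

lemma subspace_lie_algebra:
  assumes "subtorus M"
  shows "subspace (lie_algebra M)"
proof -
  have 0: "0 \<in> lie_algebra M"
    using torus_exp_real_vec_subgroup(2)[OF assms] by (simp add: lie_algebra_def)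
  have "x + y \<in> lie_algebra M" if "x \<in> lie_algebra M" "y \<in> lie_algebra M" for x y
    using lie_algebra_diff[OF assms that(1) lie_algebra_diff[OF assms 0 that(2)]] by simp
  with 0 show ?thesis by (auto simp: subspace_def lie_algebra_def)
qed

text \<open>Given \<open>\<xi>\<close> in the Lie algebra, choose \<open>q \<xi>\<close> very close to an integer vector \<open>P\<close>. The
  difference exponentiates into \<open>M\<close> because \<open>q \<xi>\<close> does, and being small it lies in the Lie algebra.
  Hence so does \<open>P\<close>, and \<open>P / q\<close> is close to \<open>\<xi>\<close>; a linear span is closed.\<close>

lemma lie_algebra_eq_span_integer_vectors:
  fixes M :: "(complex^'d) set"
  assumes M: "subtorus M"
  shows "lie_algebra M = span (lie_algebra M \<inter> integer_vectors)" (is "?V = span ?L")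
proof
  show "span ?L \<subseteq> ?V" by (rule span_minimal[OF _ subspace_lie_algebra[OF M]]) simp
  define G where "G = {\<xi>. torus_exp (real_vec \<xi>) \<in> M}"
  have V: "?V = {\<xi>. \<forall>t. t *\<^sub>R \<xi> \<in> G}" by (simp add: lie_algebra_def G_def)
  obtain e0 where e0: "0 < e0" "\<And>x t. x \<in> G \<Longrightarrow> norm x < e0 \<Longrightarrow> t *\<^sub>R x \<in> G"
    using closed_subgroup_small_elements[of G] torus_exp_real_vec_subgroup[OF M]
    unfolding G_def by metis
  show "?V \<subseteq> span ?L"
  proof
    fix \<xi> assume \<xi>: "\<xi> \<in> ?V"
    have "\<exists>y\<in>span ?L. dist y \<xi> < e" if e: "0 < e" for e
    proof -
      obtain q :: nat and p :: "'d \<Rightarrow> int" where q: "0 < q"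
        and p: "\<And>i. \<bar>real q * \<xi> $ i - of_int (p i)\<bar> < min e0 e / CARD('d)"
        using simultaneous_approximation[of "min e0 e / CARD('d)" "\<lambda>i. \<xi> $ i"] e e0(1) by auto
      define P where "P = (\<chi> i. real_of_int (p i))"
      define \<delta> where "\<delta> = real q *\<^sub>R \<xi> - P"
      have "norm \<delta> \<le> (\<Sum>i\<in>UNIV. \<bar>\<delta> $ i\<bar>)" by (rule norm_le_l1_cart)
      also have "\<dots> < (\<Sum>i\<in>(UNIV::'d set). min e0 e / CARD('d))"
        by (rule sum_strict_mono) (use p in \<open>auto simp: \<delta>_def P_def\<close>)
      finally have \<delta>: "norm \<delta> < min e0 e" by simp
      have P: "P \<in> integer_vectors" by (simp add: P_def integer_vectors_def)
      have "real q *\<^sub>R \<xi> \<in> G" using \<xi> V by blast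
      moreover have "torus_exp (real_vec \<delta>) = torus_exp (real_vec (real q *\<^sub>R \<xi>))"
        using P by (intro torus_exp_real_vec_cong) (simp add: \<delta>_def integer_vectors_def)
      ultimately have "\<delta> \<in> G" by (simp add: G_def)
      then have "\<delta> \<in> ?V" using e0(2) \<delta> V by simp
      then have "real q *\<^sub>R \<xi> - \<delta> \<in> ?V"
        using \<xi> subspace_lie_algebra[OF M] by (intro subspace_diff subspace_scale)
      then have "P \<in> ?L" using P by (simp add: \<delta>_def)
      then have "(1 / real q) *\<^sub>R P \<in> span ?L" by (intro span_scale span_base)
      moreover have "dist ((1 / real q) *\<^sub>R P) \<xi> < e"
      proof -
        have "\<xi> - (1 / real q) *\<^sub>R P = (1 / real q) *\<^sub>R \<delta>"
          using q by (simp add: \<delta>_def scaleR_diff_right)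
        then have "dist ((1 / real q) *\<^sub>R P) \<xi> = norm \<delta> / real q"
          by (metis dist_commute dist_norm norm_scaleR abs_divide abs_one abs_of_nat times_divide_eq_left mult_1)
        also have "\<dots> \<le> norm \<delta>" using q by (simp add: divide_le_eq mult_le_cancel_left1)
        finally show ?thesis using \<delta> by simp
      qed
      ultimately show ?thesis by blast
    qed
    then have "\<xi> \<in> closure (span ?L)" unfolding closure_approachable by blast
    then show "\<xi> \<in> span ?L" by (simp add: closure_closed)
  qed
qed

text \<open>Reducing the coefficients with respect to an integral basis modulo 1 does not change the
  exponential. In other words, the image of the Lie algebra under the exponential map is
  compact.\<close>

lemma compact_fundamental_domain:
  fixes M :: "(complex^'d) set"
  assumes M: "subtorus M"
  obtains K where "compact K" "K \<subseteq> lie_algebra M"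
    "\<And>x. x \<in> lie_algebra M \<Longrightarrow> \<exists>y\<in>K. torus_exp (real_vec x) = torus_exp (real_vec y)"
proof -
  let ?V = "lie_algebra M"
  obtain B where B: "B \<subseteq> ?V \<inter> integer_vectors" "independent B" "?V \<inter> integer_vectors \<subseteq> span B"
    by (rule maximal_independent_subset)
  have fin: "finite B" using B(2) by (rule independent_imp_finite)
  have VB: "?V \<subseteq> span B"
    using lie_algebra_eq_span_integer_vectors[OF M] span_minimal[OF B(3) subspace_span] by simp
  let ?K = "?V \<inter> cball 0 (\<Sum>b\<in>B. norm b)"
  have "compact ?K"
    by (intro closed_Int_compact closed_subspace subspace_lie_algebra[OF M] compact_cball)
  moreover have "\<exists>y\<in>?K. torus_exp (real_vec x) = torus_exp (real_vec y)" if x: "x \<in> ?V" for x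
  proof -
    obtain u where u: "x = (\<Sum>b\<in>B. u b *\<^sub>R b)"
      using x VB span_finite[OF fin] by auto
    define y where "y = (\<Sum>b\<in>B. frac (u b) *\<^sub>R b)"
    have "y \<in> ?V" unfolding y_def
      using B(1) subspace_lie_algebra[OF M] by (intro subspace_sum subspace_scale) auto
    moreover have "norm y \<le> (\<Sum>b\<in>B. norm b)" unfolding y_def
      by (rule sum_norm_le) (auto simp: frac_ge_0 mult_left_le_one_le frac_lt_1 less_imp_le)
    moreover have "x - y = (\<Sum>b\<in>B. of_int \<lfloor>u b\<rfloor> *\<^sub>R b)"
      by (simp add: u y_def frac_def flip: sum_subtractf scaleR_diff_left)
    then have "x - y \<in> integer_vectors"
      using B(1) by (auto simp: integer_vectors_def intro!: Ints_sum Ints_mult)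
    ultimately show ?thesis using torus_exp_real_vec_cong[of x y] by auto
  qed
  ultimately show ?thesis by (intro that[of ?K]) auto
qed

section \<open>Real and imaginary directions in the complexification\<close>

definition complex_vec :: "real^'d \<Rightarrow> real^'d \<Rightarrow> complex^'d" where
  "complex_vec x y = (\<chi> i. Complex (x $ i) (y $ i))"

lemma torus_exp_complex_vec:
  "torus_exp (complex_vec x y) $ i = torus_exp (real_vec x) $ i * of_real (exp (- (2 * pi * y $ i)))"
  by (simp add: torus_exp_def complex_vec_def real_vec_def Complex_eq algebra_simps
      flip: exp_of_real exp_add)

lemma complex_vec_in_lie_algebra_complex:
  "complex_vec x y \<in> lie_algebra_complex M \<longleftrightarrow> x \<in> lie_algebra M \<and> y \<in> lie_algebra M"
  by (simp add: lie_algebra_complex_def complex_vec_def Re_vec_def Im_vec_def)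

lemma complexification_eq:
  "complexification M = {torus_exp (complex_vec x y) | x y. x \<in> lie_algebra M \<and> y \<in> lie_algebra M}"
proof (intro equalityI subsetI)
  fix \<zeta> assume "\<zeta> \<in> complexification M"
  then obtain w where w: "w \<in> lie_algebra_complex M" "\<zeta> = torus_exp w"
    unfolding complexification_def by blast
  have "complex_vec (Re_vec w) (Im_vec w) = w"
    by (simp add: complex_vec_def Re_vec_def Im_vec_def vec_eq_iff)
  with w show "\<zeta> \<in> {torus_exp (complex_vec x y) | x y. x \<in> lie_algebra M \<and> y \<in> lie_algebra M}"
    unfolding lie_algebra_complex_def by (metis (mono_tags, lifting) mem_Collect_eq)
next
  fix \<zeta> assume "\<zeta> \<in> {torus_exp (complex_vec x y) | x y. x \<in> lie_algebra M \<and> y \<in> lie_algebra M}"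
  then show "\<zeta> \<in> complexification M"
    unfolding complexification_def using complex_vec_in_lie_algebra_complex by blast
qed

lemma norm_torus_exp_complex_vec:
  "cmod (torus_exp (complex_vec x y) $ i) = exp (- (2 * pi * y $ i))"
  by (simp add: torus_exp_complex_vec norm_mult) (simp add: torus_exp_def real_vec_def norm_exp_eq_Re)

section \<open>The cones in terms of the support\<close>

definition vec_support :: "complex^'d \<Rightarrow> 'd set" where
  "vec_support z = {i. z $ i \<noteq> 0}"

text \<open>Outside the support of \<open>z\<close> the coefficient is killed by \<open>\<bar>z\<^sub>i\<bar>\<^sup>2 = 0\<close>; the default value 1 there
  is acceptable both for nonnegative and for positive coefficients.\<close>

lemma sum_rescale_support:
  fixes z :: "complex^'d" and d \<xi> :: "'d \<Rightarrow> real"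
  shows "(\<Sum>i\<in>UNIV. (if z $ i = 0 then 1 else d i / (cmod (z $ i))\<^sup>2) * (cmod (z $ i))\<^sup>2 * \<xi> i)
    = (\<Sum>i\<in>vec_support z. d i * \<xi> i)"
  by (rule sum.mono_neutral_cong_right) (auto simp: vec_support_def)

text \<open>Stated for a sign condition \<open>P\<close> that is insensitive to positive factors, so that it covers
  the closed and the open cone at once.\<close>

lemma rescaled_combination_iff:
  fixes P :: "real \<Rightarrow> bool" and z :: "complex^'d"
  assumes \<alpha>: "\<alpha> \<in> dual_space (lie_algebra M)"
    and a: "\<And>\<xi>. \<xi> \<in> lie_algebra M \<Longrightarrow> \<alpha> \<xi> = a \<bullet> \<xi>"
    and P: "P 1" "\<And>r s. 0 < s \<Longrightarrow> P (r * s) \<longleftrightarrow> P r"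
  shows "(\<exists>c. \<alpha> = (\<lambda>\<xi>\<in>lie_algebra M. \<Sum>i\<in>UNIV. c i * (cmod (z $ i))\<^sup>2 * iota_star M (e_star i) \<xi>)
        \<and> (\<forall>i. P (c i)))
    \<longleftrightarrow> (\<exists>c. (\<forall>i\<in>vec_support z. P (c i)) \<and>
          (\<forall>\<xi>\<in>lie_algebra M. a \<bullet> \<xi> = (\<Sum>i\<in>vec_support z. c i * \<xi> $ i)))"
    (is "?lhs \<longleftrightarrow> ?rhs")
proof
  assume ?lhs
  then obtain c where c: "\<forall>i. P (c i)"
    "\<alpha> = (\<lambda>\<xi>\<in>lie_algebra M. \<Sum>i\<in>UNIV. c i * (cmod (z $ i))\<^sup>2 * iota_star M (e_star i) \<xi>)"
    by blast
  have "a \<bullet> \<xi> = (\<Sum>i\<in>vec_support z. (c i * (cmod (z $ i))\<^sup>2) * \<xi> $ i)" if "\<xi> \<in> lie_algebra M" for \<xi>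
    unfolding a[OF that, symmetric] using that
    by (simp add: c(2) iota_star_def e_star_def)
      (rule sum.mono_neutral_right, auto simp: vec_support_def)
  then show ?rhs
    using c(1) P(2) by (intro exI[of _ "\<lambda>i. c i * (cmod (z $ i))\<^sup>2"]) (simp add: vec_support_def)
next
  assume ?rhs
  then obtain d where d: "\<forall>i\<in>vec_support z. P (d i)"
    "\<And>\<xi>. \<xi> \<in> lie_algebra M \<Longrightarrow> a \<bullet> \<xi> = (\<Sum>i\<in>vec_support z. d i * \<xi> $ i)"
    by metis
  let ?c = "\<lambda>i. if z $ i = 0 then 1 else d i / (cmod (z $ i))\<^sup>2"
  have "\<alpha> = (\<lambda>\<xi>\<in>lie_algebra M. \<Sum>i\<in>UNIV. ?c i * (cmod (z $ i))\<^sup>2 * iota_star M (e_star i) \<xi>)"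
  proof (rule extensionalityI[of _ "lie_algebra M"])
    show "\<alpha> \<in> extensional (lie_algebra M)" using \<alpha> by (simp add: dual_space_def)
    fix \<xi> assume "\<xi> \<in> lie_algebra M"
    then show "\<alpha> \<xi> = (\<lambda>\<xi>\<in>lie_algebra M. \<Sum>i\<in>UNIV. ?c i * (cmod (z $ i))\<^sup>2 * iota_star M (e_star i) \<xi>) \<xi>"
      by (simp only: restrict_apply' a d(2) iota_star_def e_star_def sum_rescale_support)
  qed simp
  moreover have "P (d i / (cmod (z $ i))\<^sup>2)" if "z $ i \<noteq> 0" for i
    using d(1) that P(2)[of "1 / (cmod (z $ i))\<^sup>2" "d i"] by (simp add: vec_support_def)
  then have "\<forall>i. P (?c i)" using P(1) by simp
  ultimately show ?lhs by (intro exI[of _ ?c]) blast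
qed

lemma nonneg_cone_iff:
  assumes "\<alpha> \<in> dual_space (lie_algebra M)" "\<And>\<xi>. \<xi> \<in> lie_algebra M \<Longrightarrow> \<alpha> \<xi> = a \<bullet> \<xi>"
  shows "\<alpha> \<in> nonneg_cone M z \<longleftrightarrow> nonneg_rep (lie_algebra M) (vec_support z) a"
  using rescaled_combination_iff[of \<alpha> M a "\<lambda>r. 0 \<le> r" z, OF assms]
  unfolding nonneg_cone_def nonneg_rep_def by (simp add: zero_le_mult_iff)

lemma pos_cone_iff:
  assumes "\<alpha> \<in> dual_space (lie_algebra M)" "\<And>\<xi>. \<xi> \<in> lie_algebra M \<Longrightarrow> \<alpha> \<xi> = a \<bullet> \<xi>"
  shows "\<alpha> \<in> pos_cone M z \<longleftrightarrow> pos_rep (lie_algebra M) (vec_support z) a"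
  using rescaled_combination_iff[of \<alpha> M a "\<lambda>r. 0 < r" z, OF assms]
  unfolding pos_cone_def pos_rep_def by (simp add: zero_less_mult_iff)

section \<open>Semi-stability and equivariant polynomials\<close>

lemma weight_character_complex_vec:
  assumes "subtorus M" "\<alpha> \<in> integral_weights M" "x \<in> lie_algebra M" "y \<in> lie_algebra M"
  shows "weight_character M \<alpha> (torus_exp (complex_vec x y))
    = exp (2 * of_real pi * \<i> * Complex (\<alpha> x) (\<alpha> y))"
proof -
  have "complexify \<alpha> (complex_vec x y) = Complex (\<alpha> x) (\<alpha> y)"
    by (simp add: complexify_def complex_vec_def Re_vec_def Im_vec_def Complex_eq)
  then show ?thesis
    using weight_character_torus_exp[OF assms(1,2)] assms(3,4)
    by (simp add: complex_vec_in_lie_algebra_complex)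
qed

text \<open>With natural exponents \<open>n i\<close> representing \<open>k \<alpha>\<close>, the monomial with these exponents on the
  support of \<open>z\<close> transforms by the \<open>k\<close>-th power of the character and does not vanish at \<open>z\<close>.\<close>

lemma equivariant_monomial_exists:
  fixes M :: "(complex^'d) set"
  assumes M: "subtorus M" and \<alpha>: "\<alpha> \<in> integral_weights M"
    and a: "\<And>\<xi>. \<xi> \<in> lie_algebra M \<Longrightarrow> \<alpha> \<xi> = a \<bullet> \<xi>"
    and rep: "nonneg_rep (lie_algebra M) (vec_support z) a"
  shows "\<exists>k::nat. \<exists>f. k > 0 \<and> polynomial_on_Cd f \<and>
    (\<forall>p. \<forall>\<zeta>\<in>complexification M. f (p * \<zeta>) = f p * weight_character M \<alpha> \<zeta> ^ k) \<and> f z \<noteq> 0"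
proof -
  have "a \<bullet> b \<in> \<int>" if b: "b \<in> lie_algebra M" "b \<in> integer_vectors" for b
  proof -
    have "torus_exp (real_vec b) = torus_exp (real_vec 0)"
      using b(2) by (intro torus_exp_real_vec_cong) simp
    also have "\<dots> = 1" by (simp add: torus_exp_def real_vec_def vec_eq_iff)
    finally show ?thesis using \<alpha> b(1) a[OF b(1)] unfolding integral_weights_def by auto
  qed
  from nonneg_rep_integer_multiple[OF lie_algebra_eq_span_integer_vectors[OF M] this rep]
  obtain k :: nat and n :: "'d \<Rightarrow> nat" where k: "0 < k"
    and n: "\<And>\<xi>. \<xi> \<in> lie_algebra M \<Longrightarrow> real k * (a \<bullet> \<xi>) = (\<Sum>i\<in>vec_support z. real (n i) * \<xi> $ i)"
    by metis
  define e where "e i = (if i \<in> vec_support z then n i else 0)" for i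
  have e: "real k * \<alpha> \<xi> = (\<Sum>i\<in>UNIV. real (e i) * \<xi> $ i)" if "\<xi> \<in> lie_algebra M" for \<xi>
    unfolding a[OF that] n[OF that] by (rule sum.mono_neutral_cong_left) (auto simp: e_def)
  define f where "f p = (\<Prod>i\<in>UNIV. (p $ i) ^ e i)" for p :: "complex^'d"
  have "polynomial_on_Cd f"
    unfolding polynomial_on_Cd_def f_def by (intro exI[of _ "{e}"] exI[of _ "\<lambda>_. 1"]) auto
  moreover have "f z \<noteq> 0" by (simp add: f_def e_def vec_support_def)
  moreover have "f (p * \<zeta>) = f p * weight_character M \<alpha> \<zeta> ^ k" if "\<zeta> \<in> complexification M" for p \<zeta>
  proof -
    obtain x y where xy: "x \<in> lie_algebra M" "y \<in> lie_algebra M" "\<zeta> = torus_exp (complex_vec x y)"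
      using \<open>\<zeta> \<in> complexification M\<close> unfolding complexification_eq by blast
    have eq: "(\<Sum>i\<in>UNIV. of_nat (e i) * Complex (x $ i) (y $ i)) = of_nat k * Complex (\<alpha> x) (\<alpha> y)"
      using e[OF xy(1)] e[OF xy(2)] by (simp add: complex_eq_iff)
    have "f \<zeta> = (\<Prod>i\<in>UNIV. exp (of_nat (e i) * (2 * of_real pi * \<i> * Complex (x $ i) (y $ i))))"
      unfolding f_def xy(3) by (simp only: torus_exp_def complex_vec_def vec_lambda_beta exp_of_nat_mult)
    also have "\<dots> = exp (\<Sum>i\<in>UNIV. of_nat (e i) * (2 * of_real pi * \<i> * Complex (x $ i) (y $ i)))"
      by (simp add: exp_sum)
    also have "(\<Sum>i\<in>UNIV. of_nat (e i) * (2 * of_real pi * \<i> * Complex (x $ i) (y $ i)))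
        = 2 * of_real pi * \<i> * (\<Sum>i\<in>UNIV. of_nat (e i) * Complex (x $ i) (y $ i))"
      unfolding sum_distrib_left by (intro sum.cong) (simp_all only: mult_ac)
    also have "\<dots> = of_nat k * (2 * of_real pi * \<i> * Complex (\<alpha> x) (\<alpha> y))"
      unfolding eq by (simp only: mult_ac)
    finally have "f \<zeta> = weight_character M \<alpha> \<zeta> ^ k"
      unfolding xy(3) weight_character_complex_vec[OF M \<alpha> xy(1,2)] exp_of_nat_mult .
    moreover have "f (p * \<zeta>) = f p * f \<zeta>"
      by (simp add: f_def power_mult_distrib prod.distrib)
    ultimately show ?thesis by simp
  qed
  ultimately show ?thesis using k by blast
qed

lemma polynomial_on_Cd_bounded:
  assumes "polynomial_on_Cd f"
  obtains C where "\<And>p. \<forall>i. cmod (p $ i) \<le> r i \<Longrightarrow> cmod (f p) \<le> C"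
proof -
  obtain S c where "finite S" and f: "f = (\<lambda>p. \<Sum>a\<in>S. c a * (\<Prod>i\<in>UNIV. (p $ i) ^ a i))"
    using assms unfolding polynomial_on_Cd_def by blast
  have "cmod (f p) \<le> (\<Sum>a\<in>S. cmod (c a) * (\<Prod>i\<in>UNIV. r i ^ a i))" if "\<forall>i. cmod (p $ i) \<le> r i" for p
    unfolding f using that
    by (intro sum_norm_le) (auto simp: norm_mult norm_power simp flip: prod_norm
        intro!: mult_left_mono prod_mono power_mono)
  then show ?thesis by (rule that)
qed

text \<open>A separating direction \<open>\<xi>\<close> shrinks the coordinates of \<open>z\<close>, so \<open>f\<close> stays bounded along it,
  whereas equivariance makes \<open>\<bar>f\<bar>\<close> grow exponentially.\<close>

lemma nonneg_rep_if_equivariant_polynomial: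
  fixes M :: "(complex^'d) set"
  assumes M: "subtorus M" and \<alpha>: "\<alpha> \<in> integral_weights M"
    and a: "\<And>\<xi>. \<xi> \<in> lie_algebra M \<Longrightarrow> \<alpha> \<xi> = a \<bullet> \<xi>"
    and k: "0 < k" and poly: "polynomial_on_Cd f"
    and equi: "\<And>p \<zeta>. \<zeta> \<in> complexification M \<Longrightarrow> f (p * \<zeta>) = f p * weight_character M \<alpha> \<zeta> ^ k"
    and fz: "f z \<noteq> 0"
  shows "nonneg_rep (lie_algebra M) (vec_support z) a"
proof (rule ccontr)
  note V = subspace_lie_algebra[OF M]
  assume "\<not> ?thesis"
  then obtain \<xi> where \<xi>: "\<xi> \<in> lie_algebra M" "\<forall>i\<in>vec_support z. 0 \<le> \<xi> $ i" "a \<bullet> \<xi> < 0"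
    by (rule not_nonneg_rep_separation[OF V])
  obtain C where C: "\<And>p. \<forall>i. cmod (p $ i) \<le> cmod (z $ i) \<Longrightarrow> cmod (f p) \<le> C"
    using polynomial_on_Cd_bounded[OF poly, of "\<lambda>i. cmod (z $ i)"] by metis
  have C0: "0 \<le> C" using C[of z] norm_ge_zero[of "f z"] by (meson order.trans order.refl)
  define s where "s = - (a \<bullet> \<xi>)"
  have s: "0 < s" using \<xi>(3) by (simp add: s_def)
  \<comment> \<open>At this time the linear lower bound \<open>1 + 2 * pi * t * s\<close> for the exponential growth already
    exceeds \<open>C / cmod (f z)\<close>.\<close>
  define t where "t = C / (cmod (f z) * (2 * pi * s))"
  have t: "0 \<le> t" "cmod (f z) * (2 * pi * t * s) = C" using C0 fz s by (simp_all add: t_def)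
  have t\<xi>: "t *\<^sub>R \<xi> \<in> lie_algebra M" "0 \<in> lie_algebra M"
    using \<xi>(1) V by (auto simp: subspace_scale subspace_0)
  define \<zeta> where "\<zeta> = torus_exp (complex_vec 0 (t *\<^sub>R \<xi>))"
  have \<zeta>: "\<zeta> \<in> complexification M" using t\<xi> unfolding complexification_eq \<zeta>_def by blast
  have "cmod ((z * \<zeta>) $ i) \<le> cmod (z $ i)" for i
  proof (cases "i \<in> vec_support z")
    case True
    then show ?thesis using \<xi>(2) t(1)
      by (simp add: norm_mult \<zeta>_def norm_torus_exp_complex_vec mult_left_le)
  qed (simp add: vec_support_def)
  then have upper: "cmod (f (z * \<zeta>)) \<le> C" by (intro C) simp
  have "cmod (weight_character M \<alpha> \<zeta>) = exp (2 * pi * t * s)"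
    unfolding \<zeta>_def weight_character_complex_vec[OF M \<alpha> t\<xi>(2,1)]
    by (simp add: norm_exp_eq_Re a[OF t\<xi>(1)] s_def)
  then have "cmod (f (z * \<zeta>)) = cmod (f z) * exp (2 * pi * t * s) ^ k"
    by (simp add: equi[OF \<zeta>] norm_mult norm_power)
  moreover have "1 + 2 * pi * t * s \<le> exp (2 * pi * t * s) ^ k"
  proof -
    have "1 + 2 * pi * t * s \<le> exp (2 * pi * t * s) ^ 1" using exp_ge_add_one_self by simp
    also have "\<dots> \<le> exp (2 * pi * t * s) ^ k"
      using k s t(1) by (intro power_increasing) auto
    finally show ?thesis .
  qed
  ultimately have "cmod (f z) * (1 + 2 * pi * t * s) \<le> C"
    using upper mult_left_mono[of "1 + 2 * pi * t * s" _ "cmod (f z)"] by (metis norm_ge_zero order.trans)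
  with t(2) fz show False by (simp add: distrib_left)
qed

lemma semistable_iff_nonneg_rep:
  assumes M: "subtorus M" and \<alpha>: "\<alpha> \<in> dual_space (lie_algebra M)"
    and a: "\<And>\<xi>. \<xi> \<in> lie_algebra M \<Longrightarrow> \<alpha> \<xi> = a \<bullet> \<xi>"
  shows "semistable M \<alpha> z \<longleftrightarrow> nonneg_rep (lie_algebra M) (vec_support z) a"
proof (cases "\<alpha> \<in> integral_weights M")
  case True
  show ?thesis
  proof
    assume "nonneg_rep (lie_algebra M) (vec_support z) a"
    from equivariant_monomial_exists[OF M True a this] show "semistable M \<alpha> z"
      unfolding semistable_def if_P[OF True] .
  next
    assume "semistable M \<alpha> z"
    then obtain k :: nat and f where "0 < k" "polynomial_on_Cd f" "f z \<noteq> 0"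
      "\<forall>p. \<forall>\<zeta>\<in>complexification M. f (p * \<zeta>) = f p * weight_character M \<alpha> \<zeta> ^ k"
      unfolding semistable_def if_P[OF True] by blast
    then show "nonneg_rep (lie_algebra M) (vec_support z) a"
      by (intro nonneg_rep_if_equivariant_polynomial[OF M True a, of k f z]) auto
  qed
next
  case False
  then show ?thesis using nonneg_cone_iff[OF \<alpha> a] by (simp add: semistable_def)
qed

section \<open>Closed orbits\<close>

lemma closedin_top_of_set_sequentially:
  fixes S U :: "'a::metric_space set"
  shows "closedin (top_of_set S) U \<longleftrightarrow>
    U \<subseteq> S \<and> (\<forall>x l. (\<forall>n. x n \<in> U) \<and> l \<in> S \<and> x \<longlonglongrightarrow> l \<longrightarrow> l \<in> U)"
proof -
  have "(\<forall>x. x islimpt U \<and> x \<in> S \<longrightarrow> x \<in> U) \<longleftrightarrow> S \<inter> closure U \<subseteq> U"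
    by (auto simp: closure_def)
  moreover have "S \<inter> closure U \<subseteq> U \<longleftrightarrow> (\<forall>x l. (\<forall>n. x n \<in> U) \<and> l \<in> S \<and> x \<longlonglongrightarrow> l \<longrightarrow> l \<in> U)"
    unfolding subset_iff Int_iff closure_sequential by blast
  ultimately show ?thesis by (simp add: closedin_limpt)
qed

lemma torus_orbit_eq:
  "torus_orbit M z = {z * torus_exp (complex_vec x y) | x y. x \<in> lie_algebra M \<and> y \<in> lie_algebra M}"
  unfolding torus_orbit_def complexification_eq by blast

lemma vec_support_mult_torus_exp: "vec_support (z * torus_exp w) = vec_support z"
  by (simp add: vec_support_def torus_exp_def)

text \<open>A direction \<open>\<xi>\<close> from \<open>not_pos_rep_separation\<close> contracts the orbit to a point with strictly
  smaller support. That point is semi-stable, since \<open>a \<bullet> \<xi> \<le> 0\<close> forces the coefficients of \<open>a\<close> to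
  vanish where \<open>\<xi>\<close> is positive.\<close>

lemma pos_rep_if_orbit_closed:
  fixes M :: "(complex^'d) set"
  assumes M: "subtorus M" and rep: "nonneg_rep (lie_algebra M) (vec_support z) a"
    and cl: "closedin (top_of_set {p. nonneg_rep (lie_algebra M) (vec_support p) a}) (torus_orbit M z)"
  shows "pos_rep (lie_algebra M) (vec_support z) a"
proof (rule ccontr)
  note V = subspace_lie_algebra[OF M]
  let ?I = "vec_support z"
  assume "\<not> ?thesis"
  then obtain \<xi> j where \<xi>: "\<xi> \<in> lie_algebra M" "\<forall>i\<in>?I. 0 \<le> \<xi> $ i" "a \<bullet> \<xi> \<le> 0"
    and j: "j \<in> ?I" "0 < \<xi> $ j"
    by (rule not_pos_rep_separation[OF V rep])
  obtain c where c: "\<forall>i\<in>?I. 0 \<le> c i" "\<And>\<eta>. \<eta> \<in> lie_algebra M \<Longrightarrow> a \<bullet> \<eta> = (\<Sum>i\<in>?I. c i * \<eta> $ i)"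
    using rep unfolding nonneg_rep_def by metis
  have nn: "0 \<le> c i * \<xi> $ i" if "i \<in> ?I" for i using c(1) \<xi>(2) that by simp
  have "(\<Sum>i\<in>?I. c i * \<xi> $ i) = 0"
    using \<xi>(3) c(2)[OF \<xi>(1)] sum_nonneg[of ?I "\<lambda>i. c i * \<xi> $ i"] nn by fastforce
  then have czero: "c i * \<xi> $ i = 0" if "i \<in> ?I" for i
    using that nn by (simp add: sum_nonneg_eq_0_iff)
  define z0 where "z0 = (\<chi> i. if \<xi> $ i = 0 then z $ i else 0)"
  have supp0: "vec_support z0 = {i \<in> ?I. \<xi> $ i = 0}" by (auto simp: z0_def vec_support_def)
  have "a \<bullet> \<eta> = (\<Sum>i\<in>vec_support z0. c i * \<eta> $ i)" if "\<eta> \<in> lie_algebra M" for \<eta>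
    unfolding c(2)[OF that] using czero
    by (intro sum.mono_neutral_right) (auto simp: supp0)
  then have ss0: "nonneg_rep (lie_algebra M) (vec_support z0) a"
    unfolding nonneg_rep_def using c(1) by (intro exI[of _ c]) (simp add: supp0)
  define x where "x n = z * torus_exp (complex_vec 0 (real n *\<^sub>R \<xi>))" for n
  have "x n \<in> torus_orbit M z" for n
    unfolding torus_orbit_eq x_def using \<xi>(1) V subspace_0 subspace_scale by blast
  moreover have "x \<longlonglongrightarrow> z0"
  proof (rule vec_tendstoI)
    fix i
    have xi: "x n $ i = z $ i * of_real (exp (- (2 * pi * \<xi> $ i)) ^ n)" for n
      by (simp add: x_def torus_exp_complex_vec algebra_simps flip: exp_of_nat_mult)
        (simp add: torus_exp_def real_vec_def)
    show "(\<lambda>n. x n $ i) \<longlonglongrightarrow> z0 $ i"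
    proof (cases "i \<in> ?I \<and> \<xi> $ i \<noteq> 0")
      case True
      then have "0 < \<xi> $ i" using \<xi>(2) by force
      then have "(\<lambda>n. exp (- (2 * pi * \<xi> $ i)) ^ n) \<longlonglongrightarrow> 0" by (intro LIMSEQ_realpow_zero) auto
      then have "(\<lambda>n. x n $ i) \<longlonglongrightarrow> z $ i * of_real 0" unfolding xi by (intro tendsto_mult tendsto_const tendsto_of_real)
      then show ?thesis using True by (simp add: z0_def)
    next
      case False
      then have "x n $ i = z0 $ i" for n by (auto simp: xi z0_def vec_support_def)
      then show ?thesis by simp
    qed
  qed
  ultimately have "z0 \<in> torus_orbit M z"
    using cl ss0 unfolding closedin_top_of_set_sequentially by blast
  then have "vec_support z0 = ?I"
    unfolding torus_orbit_def complexification_def by (auto simp: vec_support_mult_torus_exp)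
  then have "j \<in> {i \<in> ?I. \<xi> $ i = 0}" using j(1) supp0 by metis
  with j(2) show False by simp
qed

text \<open>The indices in \<open>I\<close> with \<open>l i = 0\<close> are those where \<open>y n $ i\<close> tends to infinity, and on the others
  \<open>y n $ i\<close> converges. The two representations of \<open>a\<close> express a positive combination of the
  diverging coordinates as a combination of the converging ones, so there are no
  diverging ones.\<close>

lemma exponential_limit_nonzero:
  fixes V :: "(real^'d) set" and l :: "'d \<Rightarrow> real"
  assumes pos: "pos_rep V I a" and nonneg: "nonneg_rep V {i \<in> I. l i \<noteq> 0} a"
    and y: "\<And>n. y n \<in> V"
    and lim: "\<And>i. i \<in> I \<Longrightarrow> (\<lambda>n. exp (- (2 * pi * y n $ i))) \<longlonglongrightarrow> l i"
    and j: "j \<in> I"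
  shows "l j \<noteq> 0"
proof
  assume "l j = 0"
  define J where "J = {i \<in> I. l i \<noteq> 0}"
  have jJ: "j \<in> I - J" and JI: "J \<subseteq> I" using j \<open>l j = 0\<close> by (auto simp: J_def)
  obtain c where c: "\<forall>i\<in>I. 0 < c i" "\<And>\<eta>. \<eta> \<in> V \<Longrightarrow> a \<bullet> \<eta> = (\<Sum>i\<in>I. c i * \<eta> $ i)"
    using pos unfolding pos_rep_def by metis
  obtain b where b: "\<And>\<eta>. \<eta> \<in> V \<Longrightarrow> a \<bullet> \<eta> = (\<Sum>i\<in>J. b i * \<eta> $ i)"
    using nonneg unfolding nonneg_rep_def J_def by metis
  have split: "(\<Sum>i\<in>I - J. c i * y n $ i) = (\<Sum>i\<in>J. (b i - c i) * y n $ i)" for n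
    using b[OF y[of n]] c(2)[OF y[of n]] sum.subset_diff[OF JI, of "\<lambda>i. c i * y n $ i"]
    by (simp add: left_diff_distrib sum_subtractf)
  have "(\<lambda>n. y n $ i) \<longlonglongrightarrow> - ln (l i) / (2 * pi)" if "i \<in> J" for i
  proof -
    have "(\<lambda>n. - ln (exp (- (2 * pi * y n $ i))) / (2 * pi)) \<longlonglongrightarrow> - ln (l i) / (2 * pi)"
      using that by (intro tendsto_divide tendsto_minus tendsto_ln tendsto_const lim) (auto simp: J_def)
    then show ?thesis by simp
  qed
  then have "(\<lambda>n. \<Sum>i\<in>J. (b i - c i) * y n $ i) \<longlonglongrightarrow> (\<Sum>i\<in>J. (b i - c i) * (- ln (l i) / (2 * pi)))"
    by (intro tendsto_sum tendsto_mult tendsto_const)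
  then have "Bseq (\<lambda>n. \<Sum>i\<in>J. (b i - c i) * y n $ i)"
    by (intro convergent_imp_Bseq convergentI)
  then obtain R where R: "\<forall>n. norm (\<Sum>i\<in>J. (b i - c i) * y n $ i) \<le> R"
    unfolding Bseq_def by blast
  have top: "filterlim (\<lambda>n. y n $ i) at_top sequentially" if "i \<in> I - J" for i
  proof -
    have "(\<lambda>n. exp (- (2 * pi * y n $ i))) \<longlonglongrightarrow> 0"
      using lim[of i] that by (simp add: J_def)
    then have "filterlim (\<lambda>n. exp (- (2 * pi * y n $ i))) (at_right 0) sequentially"
      by (simp add: filterlim_at)
    then have "filterlim (\<lambda>n. ln (exp (- (2 * pi * y n $ i)))) at_bot sequentially"
      by (rule filterlim_compose[OF ln_at_0])
    then have "filterlim (\<lambda>n. 2 * pi * y n $ i) at_top sequentially"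
      by (simp add: filterlim_uminus_at_top)
    then have "filterlim (\<lambda>n. 1 / (2 * pi) * (2 * pi * y n $ i)) at_top sequentially"
      by (rule filterlim_tendsto_pos_mult_at_top[OF tendsto_const, rotated]) simp
    moreover have "1 / (2 * pi) * (2 * pi * r) = r" for r by simp
    ultimately show ?thesis by (simp only:)
  qed
  have "eventually (\<lambda>n. \<forall>i\<in>I - J. 0 \<le> y n $ i) sequentially"
    using top by (intro eventually_ball_finite) (auto simp: filterlim_at_top)
  moreover have "eventually (\<lambda>n. (R + 1) / c j \<le> y n $ j) sequentially"
    using top[OF jJ] by (simp add: filterlim_at_top)
  ultimately have "eventually (\<lambda>n. False) sequentially"
  proof eventually_elim
    case (elim n)
    have "R + 1 \<le> c j * y n $ j" using elim(2) c(1) j by (simp add: divide_le_eq mult.commute)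
    also have "\<dots> \<le> (\<Sum>i\<in>I - J. c i * y n $ i)"
      using jJ elim(1) c(1) by (intro member_le_sum) (auto intro: less_imp_le)
    also have "\<dots> \<le> R" unfolding split using spec[OF R, of n] by (simp only: real_norm_def abs_le_iff)
    finally show ?case by simp
  qed
  then show False by simp
qed

text \<open>The image of \<open>V\<close> under restriction to the coordinates in \<open>I\<close> is a subspace, hence closed; the
  remaining coordinates of \<open>y n\<close> need not converge.\<close>

lemma subspace_coordinatewise_limit:
  fixes V :: "(real^'d) set"
  assumes V: "subspace V" and y: "\<And>n. y n \<in> V" and lim: "\<And>i. i \<in> I \<Longrightarrow> (\<lambda>n. y n $ i) \<longlonglongrightarrow> \<eta> i"
  obtains Y where "Y \<in> V" "\<And>i. i \<in> I \<Longrightarrow> Y $ i = \<eta> i"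
proof -
  define r where "r u = (\<chi> i. if i \<in> I then u $ i else 0)" for u :: "real^'d"
  have "linear r" by (rule linearI) (auto simp: r_def vec_eq_iff)
  then have "closed (r ` V)"
    using V by (intro closed_subspace linear_subspace_image)
  moreover have "r (y n) \<in> r ` V" for n using y by blast
  moreover have "(\<lambda>n. r (y n)) \<longlonglongrightarrow> (\<chi> i. if i \<in> I then \<eta> i else 0)"
    using lim by (intro vec_tendstoI) (simp add: r_def)
  ultimately have "(\<chi> i. if i \<in> I then \<eta> i else 0) \<in> r ` V"
    by (rule closed_sequentially)
  then obtain Y where Y: "Y \<in> V" "(\<chi> i. if i \<in> I then \<eta> i else 0) = r Y" by blast
  have "Y $ i = \<eta> i" if "i \<in> I" for i
    using arg_cong[OF Y(2), of "\<lambda>u. u $ i"] that by (simp add: r_def)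
  with Y(1) show ?thesis by (rule that)
qed

text \<open>Convergence of a sequence in the orbit controls the imaginary directions \<open>y n\<close> on the
  support by \<open>exponential_limit_nonzero\<close>; the real directions \<open>x n\<close> only matter modulo integer
  vectors and have a convergent subsequence.\<close>

lemma orbit_closed_if_pos_rep:
  fixes M :: "(complex^'d) set"
  assumes M: "subtorus M" and rep: "pos_rep (lie_algebra M) (vec_support z) a"
  shows "closedin (top_of_set {p. nonneg_rep (lie_algebra M) (vec_support p) a}) (torus_orbit M z)"
  unfolding closedin_top_of_set_sequentially
proof (intro conjI allI impI)
  note V = subspace_lie_algebra[OF M]
  let ?I = "vec_support z"
  obtain c where c: "\<forall>i\<in>?I. 0 < c i" "\<forall>\<eta>\<in>lie_algebra M. a \<bullet> \<eta> = (\<Sum>i\<in>?I. c i * \<eta> $ i)"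
    using rep unfolding pos_rep_def by blast
  have "nonneg_rep (lie_algebra M) ?I a"
    unfolding nonneg_rep_def using c by (intro exI[of _ c]) (auto intro: less_imp_le)
  then show "torus_orbit M z \<subseteq> {p. nonneg_rep (lie_algebra M) (vec_support p) a}"
    unfolding torus_orbit_def complexification_def by (auto simp: vec_support_mult_torus_exp)
  fix p q
  assume "(\<forall>n. p n \<in> torus_orbit M z) \<and> q \<in> {p. nonneg_rep (lie_algebra M) (vec_support p) a} \<and> p \<longlonglongrightarrow> q"
  then have p: "\<forall>n. p n \<in> torus_orbit M z" and q: "nonneg_rep (lie_algebra M) (vec_support q) a"
    and lim: "p \<longlonglongrightarrow> q" by auto
  let ?J = "vec_support q"
  obtain K where K: "compact K" "K \<subseteq> lie_algebra M"
    "\<And>x. x \<in> lie_algebra M \<Longrightarrow> \<exists>y\<in>K. torus_exp (real_vec x) = torus_exp (real_vec y)"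
    using compact_fundamental_domain[OF M] by metis
  have "\<forall>n. \<exists>xy. fst xy \<in> K \<and> snd xy \<in> lie_algebra M \<and>
      (\<forall>i. p n $ i = z $ i * (torus_exp (real_vec (fst xy)) $ i * of_real (exp (- (2 * pi * snd xy $ i)))))"
  proof
    fix n
    obtain x y where xy: "x \<in> lie_algebra M" "y \<in> lie_algebra M" "p n = z * torus_exp (complex_vec x y)"
      using p unfolding torus_orbit_eq by blast
    obtain x' where "x' \<in> K" "torus_exp (real_vec x) = torus_exp (real_vec x')" using K(3)[OF xy(1)] by blast
    then show "\<exists>xy. fst xy \<in> K \<and> snd xy \<in> lie_algebra M \<and>
      (\<forall>i. p n $ i = z $ i * (torus_exp (real_vec (fst xy)) $ i * of_real (exp (- (2 * pi * snd xy $ i)))))"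
      using xy by (intro exI[of _ "(x', y)"]) (simp add: torus_exp_complex_vec)
  qed
  then obtain xy where xy: "\<forall>n. fst (xy n) \<in> K \<and> snd (xy n) \<in> lie_algebra M \<and>
      (\<forall>i. p n $ i = z $ i * (torus_exp (real_vec (fst (xy n))) $ i * of_real (exp (- (2 * pi * snd (xy n) $ i)))))"
    by (rule choice[THEN exE])
  define x where "x n = fst (xy n)" for n
  define y where "y n = snd (xy n)" for n
  have xK: "x n \<in> K" and yV: "y n \<in> lie_algebra M"
    and pn: "p n $ i = z $ i * (torus_exp (real_vec (x n)) $ i * of_real (exp (- (2 * pi * y n $ i))))" for n i
    using xy by (auto simp: x_def y_def)
  have limi: "(\<lambda>n. p n $ i) \<longlonglongrightarrow> q $ i" for i using lim by (intro tendsto_vec_nth)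
  have "q $ i = 0" if "i \<notin> ?I" for i
  proof -
    have "p n $ i = 0" for n using that by (simp add: pn vec_support_def)
    then show ?thesis using limi[of i] by (simp add: LIMSEQ_const_iff)
  qed
  then have JI: "?J \<subseteq> ?I" by (auto simp: vec_support_def)
  have modp: "cmod (p n $ i) = cmod (z $ i) * exp (- (2 * pi * y n $ i))" for n i
    unfolding pn by (simp add: norm_mult) (simp add: torus_exp_def real_vec_def norm_exp_eq_Re)
  have explim: "(\<lambda>n. exp (- (2 * pi * y n $ i))) \<longlonglongrightarrow> cmod (q $ i) / cmod (z $ i)" if "i \<in> ?I" for i
  proof -
    have "(\<lambda>n. cmod (p n $ i) / cmod (z $ i)) \<longlonglongrightarrow> cmod (q $ i) / cmod (z $ i)"
      using that by (intro tendsto_intros limi) (simp add: vec_support_def)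
    then show ?thesis using that by (simp add: modp vec_support_def)
  qed
  have "?J = {i \<in> ?I. cmod (q $ i) / cmod (z $ i) \<noteq> 0}"
    using JI by (auto simp: vec_support_def)
  with q have "cmod (q $ i) / cmod (z $ i) \<noteq> 0" if "i \<in> ?I" for i
    by (intro exponential_limit_nonzero[OF rep _ yV explim that]) simp_all
  then have "?J = ?I" using JI by (auto simp: vec_support_def)
  define \<eta> where "\<eta> i = - ln (cmod (q $ i) / cmod (z $ i)) / (2 * pi)" for i
  have ylim: "(\<lambda>n. y n $ i) \<longlonglongrightarrow> \<eta> i" if "i \<in> ?I" for i
  proof -
    have "(\<lambda>n. - ln (exp (- (2 * pi * y n $ i))) / (2 * pi)) \<longlonglongrightarrow> \<eta> i"
      unfolding \<eta>_def using that \<open>?J = ?I\<close>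
      by (intro tendsto_divide tendsto_minus tendsto_ln tendsto_const explim) (auto simp: vec_support_def)
    then show ?thesis by simp
  qed
  obtain Y where Y: "Y \<in> lie_algebra M" "\<And>i. i \<in> ?I \<Longrightarrow> Y $ i = \<eta> i"
    using subspace_coordinatewise_limit[where y = y and I = ?I, OF V yV ylim] by metis
  obtain X s where X: "X \<in> K" and s: "strict_mono s" "(x \<circ> s) \<longlonglongrightarrow> X"
    using compact_imp_seq_compact[OF K(1)] xK by (meson seq_compactE)
  have "q $ i = (z * torus_exp (complex_vec X Y)) $ i" for i
  proof (cases "i \<in> ?I")
    case True
    have "isCont (\<lambda>u. torus_exp (real_vec u) $ i) X"
      unfolding torus_exp_def real_vec_def by (simp add: continuous_intros)
    then have "(\<lambda>n. torus_exp (real_vec (x (s n))) $ i) \<longlonglongrightarrow> torus_exp (real_vec X) $ i"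
      using s(2) isCont_tendsto_compose by (fastforce simp: o_def)
    moreover have "(\<lambda>n. y (s n) $ i) \<longlonglongrightarrow> Y $ i"
      using LIMSEQ_subseq_LIMSEQ[OF ylim s(1), of i] True Y(2) by (simp add: o_def)
    ultimately have "(\<lambda>n. p (s n) $ i) \<longlonglongrightarrow>
        z $ i * (torus_exp (real_vec X) $ i * of_real (exp (- (2 * pi * Y $ i))))"
      unfolding pn by (intro tendsto_mult tendsto_const tendsto_of_real tendsto_exp tendsto_minus)
    moreover have "(\<lambda>n. p (s n) $ i) \<longlonglongrightarrow> q $ i"
      using LIMSEQ_subseq_LIMSEQ[OF limi s(1), of i] by (simp add: o_def)
    ultimately show ?thesis
      using LIMSEQ_unique by (fastforce simp: torus_exp_complex_vec)
  next
    case False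
    then show ?thesis using \<open>?J = ?I\<close> by (auto simp: vec_support_def)
  qed
  then have "q = z * torus_exp (complex_vec X Y)" by (simp add: vec_eq_iff)
  then show "q \<in> torus_orbit M z" using X K(2) Y(1) unfolding torus_orbit_eq by blast
qed

section \<open>Semi-stability and closed orbits in terms of cones\<close>

theorem lemma3p1:
  fixes M :: "(complex^'d) set" and m :: nat
    and \<alpha> :: "real^'d \<Rightarrow> real" and z :: "complex^'d"
  assumes "subtorus M" and "dim (lie_algebra M) = m"
    and "\<alpha> \<in> dual_space (lie_algebra M)"
  shows "(semistable M \<alpha> z \<longleftrightarrow> \<alpha> \<in> nonneg_cone M z) \<and>
    (z \<in> semistable_points M \<alpha> \<longrightarrow>
       (closedin (top_of_set (semistable_points M \<alpha>)) (torus_orbit M z) \<longleftrightarrow> \<alpha> \<in> pos_cone M z))"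
proof -
  obtain a where a: "\<And>\<xi>. \<xi> \<in> lie_algebra M \<Longrightarrow> \<alpha> \<xi> = a \<bullet> \<xi>"
    using functional_is_inner[OF subspace_lie_algebra[OF assms(1)] assms(3)] by metis
  have ss: "semistable M \<alpha> p \<longleftrightarrow> nonneg_rep (lie_algebra M) (vec_support p) a" for p
    by (rule semistable_iff_nonneg_rep[OF assms(1,3) a])
  have "semistable_points M \<alpha> = {p. nonneg_rep (lie_algebra M) (vec_support p) a}"
    by (simp add: semistable_points_def ss)
  moreover have "\<alpha> \<in> pos_cone M z \<longleftrightarrow> pos_rep (lie_algebra M) (vec_support z) a"
    by (rule pos_cone_iff[OF assms(3) a])
  moreover have "\<alpha> \<in> nonneg_cone M z \<longleftrightarrow> nonneg_rep (lie_algebra M) (vec_support z) a"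
    by (rule nonneg_cone_iff[OF assms(3) a])
  ultimately show ?thesis
    using pos_rep_if_orbit_closed[OF assms(1), of z a] orbit_closed_if_pos_rep[OF assms(1), of z a] ss[of z]
    by simp blast
qed

end
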